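(* Let $d\ge 3$ and let $\varrho$ be a locally maximally mixed state of two qudits with correlation matrix $\mathcal{K}\in\mathbb{K}^{(d)}$, i.e. $\varrho=\frac{1}{d^{2}}\bigl(\mathbb{1}_{d}\otimes\mathbb{1}_{d}+\sum_{j=1}^{d^{2}-1}\langle \mathcal{K}e_{j},\lambda\rangle\otimes\langle e_{j},\lambda\rangle\bigr)$. Let $\eta_{1}^{\downarrow}\ge\eta_{2}^{\downarrow}\ge\dots\ge\eta_{d^{2}-1}^{\downarrow}$ be the eigenvalues of $\mathcal{K}\mathcal{K}^{T}$ (with multiplicity) in non-increasing order, and put $\Xi(\mathcal{K})=\sum_{j=d}^{d^{2}-1}\eta_{j}^{\downarrow}$. Then $$D_{2}^{M}(\varrho)\ \ge\ \frac{4}{d^{3}(d-1)}\,\Xi(\mathcal{K})\qquad\text{and}\qquad D_{1}^{M}(\varrho)\ \ge\ \frac{1}{d(d-1)}\,\sqrt{\Xi(\mathcal{K})}.$$ In particular, if $\operatorname{rank}\mathcal{K}\ge d$, then $\varrho$ has non-zero quantum discord (both $D_1^M(\varrho)>0$ and $D_2^M(\varrho)>0$).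
   Context: Generators: $\lambda_{1},\dots,\lambda_{d^{2}-1}$ are the standard (generalized Gell-Mann) Hermitian generators of $\mathrm{su}(d)$: for $k=2,\dots,d$ and $1\le j<k$, $\lambda_{(k-1)^{2}+2(j-1)}=E_{jk}+E_{kj}$, $\lambda_{(k-1)^{2}+2(j-1)+1}=-i(E_{jk}-E_{kj})$, and $\lambda_{k^{2}-1}=\sqrt{\tfrac{2}{k(k-1)}}\,\mathrm{diag}(1,\dots,1,-(k-1),0,\dots,0)$ (with $k-1$ ones), where $E_{jk}$ are matrix units. They satisfy $\operatorname{tr}\lambda_j=0$, $\operatorname{tr}(\lambda_j\lambda_k)=2\delta_{jk}$. For $n\in\mathbb{R}^{d^{2}-1}$, $\langle n,\lambda\rangle=\sum_j n_j\lambda_j$; $\{e_j\}$ is the canonical basis of $\mathbb{R}^{d^{2}-1}$. States: a state of two qudits is a positive semidefinite operator of trace one on $\mathbb{C}^{d}\otimes\mathbb{C}^{d}$. It is locally maximally mixed if both partial traces equal $\mathbb{1}_d/d$; such states are exactly those of the form $\varrho=\frac{1}{d^{2}}(\mathbb{1}_{d}\otimes\mathbb{1}_{d}+\sum_{j}\langle \mathcal{K}e_{j},\lambda\rangle\otimes\langle e_{j},\lambda\rangle)$ with $\mathcal{K}\in M_{d^2-1}(\mathbb{R})$ (the correlation matrix) such that $\varrho\ge 0$. $\mathbb{K}^{(d)}$ denotes the set of all such matrices $\mathcal{K}$. Discord: a local projective measurement on the first subsystem is $\mathbb{P}_{\mathcal{A}}=\mathbb{P}\otimes\mathrm{id}$,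 $\mathbb{P}(A)=\sum_{k=1}^{d}P_kAP_k$, where $P_1,\dots,P_d$ are mutually orthogonal one-dimensional orthogonal projectors on $\mathbb{C}^d$ with $\sum_k P_k=\mathbb{1}_d$. With $\|A\|_1=\operatorname{tr}|A|$, $\|A\|_2=\sqrt{\operatorname{tr}A^*A}$, $$D_1^M(\varrho)=\frac{d}{2(d-1)}\min_{\mathbb{P}_{\mathcal{A}}}\|\varrho-\mathbb{P}_{\mathcal{A}}(\varrho)\|_1,\qquad D_2^M(\varrho)=\frac{d}{d-1}\min_{\mathbb{P}_{\mathcal{A}}}\|\varrho-\mathbb{P}_{\mathcal{A}}(\varrho)\|_2^2,$$ the minima being over all such measurements. *)

theory Defs
  imports Complex_Main
    "HOL-Library.Multiset"
    "HOL-Library.Discrete_Functions"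
    "HOL-Computational_Algebra.Polynomial"
    "Jordan_Normal_Form.Char_Poly"
    "Jordan_Normal_Form.Schur_Decomposition"
    "Jordan_Normal_Form.DL_Rank"
begin

section \<open>Matrices\<close>

definition sum_square_mats :: "nat \<Rightarrow> 'i set \<Rightarrow> ('i \<Rightarrow> 'a :: comm_monoid_add mat) \<Rightarrow> 'a mat" where
  "sum_square_mats n I F = mat n n (\<lambda>(a, b). \<Sum>i\<in>I. F i $$ (a, b))"

definition tr :: "'a :: comm_monoid_add mat \<Rightarrow> 'a" where
  "tr A = (\<Sum>i<dim_row A. A $$ (i, i))"

text \<open>
  The basis vector \<open>e\<^sub>i \<otimes> e\<^sub>j\<close> (counting from 0) of a tensor product whose
  second factor has dimension \<open>m\<close> gets the index \<open>i * m + j\<close>.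
\<close>

definition tensor_mat :: "'a :: times mat \<Rightarrow> 'a mat \<Rightarrow> 'a mat" (infixr "\<otimes>\<^sub>m" 71) where
  "A \<otimes>\<^sub>m B = mat (dim_row A * dim_row B) (dim_col A * dim_col B)
     (\<lambda>(a, b). A $$ (a div dim_row B, b div dim_col B) * B $$ (a mod dim_row B, b mod dim_col B))"

definition ptrace_fst :: "nat \<Rightarrow> complex mat \<Rightarrow> complex mat" where
  "ptrace_fst d A = mat d d (\<lambda>(i, j). \<Sum>k<d. A $$ (k * d + i, k * d + j))"

definition ptrace_snd :: "nat \<Rightarrow> complex mat \<Rightarrow> complex mat" where
  "ptrace_snd d A = mat d d (\<lambda>(i, j). \<Sum>k<d. A $$ (i * d + k, j * d + k))"

text \<open>In the order on \<^typ>\<open>complex\<close> used here, \<open>0 \<le> z\<close> means that \<open>z\<close> is real and non-negative.\<close>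

definition psd :: "nat \<Rightarrow> complex mat \<Rightarrow> bool" where
  "psd n A \<longleftrightarrow> A \<in> carrier_mat n n \<and> mat_adjoint A = A \<and>
     (\<forall>v\<in>carrier_vec n. 0 \<le> (A *\<^sub>v v) \<bullet>c v)"

definition abs_mat :: "complex mat \<Rightarrow> complex mat" where
  "abs_mat A = (THE B. psd (dim_col A) B \<and> B * B = mat_adjoint A * A)"

definition norm1 :: "complex mat \<Rightarrow> real" where
  "norm1 A = Re (tr (abs_mat A))"

definition norm2 :: "complex mat \<Rightarrow> real" where
  "norm2 A = sqrt (Re (tr (mat_adjoint A * A)))"

text \<open>
  Roots of the characteristic polynomial with multiplicity, in non-increasing order.  For a
  symmetric \<open>n \<times> n\<close> matrix all complex eigenvalues are real, so that the list has length \<open>n\<close>.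
\<close>

definition eigenvalues_desc :: "real mat \<Rightarrow> real list" where
  "eigenvalues_desc A = rev (sorted_list_of_multiset (proots (char_poly A)))"


section \<open>Generators of su(d)\<close>

text \<open>\<open>E\<^sub>j\<^sub>k\<close> with indices counted from 1.\<close>

definition matrix_unit :: "nat \<Rightarrow> nat \<Rightarrow> nat \<Rightarrow> complex mat" where
  "matrix_unit d j k = mat d d (\<lambda>(a, b). if a + 1 = j \<and> b + 1 = k then 1 else 0)"

text \<open>
  The generator with index \<open>m \<in> {1..d\<^sup>2 - 1}\<close>.  The number \<open>k\<close> is determined
  by \<open>(k - 1)\<^sup>2 \<le> m \<le> k\<^sup>2 - 1\<close>; for \<open>m < k\<^sup>2 - 1\<close> the offset \<open>m - (k - 1)\<^sup>2\<close> is
  \<open>2 (j - 1)\<close> or \<open>2 (j - 1) + 1\<close>.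
\<close>

definition generator :: "nat \<Rightarrow> nat \<Rightarrow> complex mat" where
  "generator d m =
     (let k = floor_sqrt m + 1; r = m - (k - 1)\<^sup>2; j = r div 2 + 1 in
      if m = k\<^sup>2 - 1 then
        complex_of_real (sqrt (2 / (real k * (real k - 1)))) \<cdot>\<^sub>m
          mat d d (\<lambda>(a, b). if a \<noteq> b then 0 else if a + 1 < k then 1
                            else if a + 1 = k then - (of_nat k - 1) else 0)
      else if even r then matrix_unit d j k + matrix_unit d k j
      else (- \<i>) \<cdot>\<^sub>m (matrix_unit d j k - matrix_unit d k j))"

lemma generator_index:
  assumes "(k - 1)\<^sup>2 \<le> m" and "m < k\<^sup>2"
  shows "floor_sqrt m + 1 = k"
proof -
  have "k > 0"
    using assms(2) by (cases k) auto
  then have "m < (Suc (k - 1))\<^sup>2"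
    using assms(2) by simp
  with assms(1) have "floor_sqrt m = k - 1"
    by (rule floor_sqrt_unique)
  then show ?thesis
    using \<open>k > 0\<close> by simp
qed

lemma
  assumes "1 \<le> j" and "j < k"
  shows generator_sym:
      "generator d ((k - 1)\<^sup>2 + 2 * (j - 1)) = matrix_unit d j k + matrix_unit d k j"
    and generator_antisym:
      "generator d ((k - 1)\<^sup>2 + 2 * (j - 1) + 1) = (- \<i>) \<cdot>\<^sub>m (matrix_unit d j k - matrix_unit d k j)"
proof -
  obtain i l where j: "j = Suc i" and k: "k = Suc (Suc (i + l))"
    using assms by (metis One_nat_def Suc_leD Suc_le_eq add_Suc le_Suc_ex not0_implies_Suc not_one_le_zero)
  have sq: "k\<^sup>2 - 1 = (k - 1)\<^sup>2 + 2 * (j - 1) + 2 * l + 2" "k\<^sup>2 > 0"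
    using j k by (auto simp: power2_eq_square)
  have "floor_sqrt ((k - 1)\<^sup>2 + 2 * (j - 1)) + 1 = k"
    by (rule generator_index) (use sq in linarith)+
  then show "generator d ((k - 1)\<^sup>2 + 2 * (j - 1)) = matrix_unit d j k + matrix_unit d k j"
    unfolding generator_def Let_def using sq assms by simp
  have "floor_sqrt ((k - 1)\<^sup>2 + 2 * (j - 1) + 1) + 1 = k"
    by (rule generator_index) (use sq in linarith)+
  then show "generator d ((k - 1)\<^sup>2 + 2 * (j - 1) + 1) = (- \<i>) \<cdot>\<^sub>m (matrix_unit d j k - matrix_unit d k j)"
    unfolding generator_def Let_def using sq assms by simp
qed

lemma generator_diag:
  assumes "2 \<le> k"
  shows "generator d (k\<^sup>2 - 1) =
    complex_of_real (sqrt (2 / (real k * (real k - 1)))) \<cdot>\<^sub>m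
      mat d d (\<lambda>(a, b). if a \<noteq> b then 0 else if a + 1 < k then 1
                        else if a + 1 = k then - (of_nat k - 1) else 0)"
proof -
  obtain i where k: "k = Suc i" and "i > 0"
    using assms by (cases k) auto
  have "floor_sqrt (k\<^sup>2 - 1) + 1 = k"
    by (rule generator_index) (use k \<open>i > 0\<close> in \<open>auto simp: power2_eq_square\<close>)
  then show ?thesis
    unfolding generator_def Let_def by (simp only: if_True refl)
qed

text \<open>\<open>\<langle>n, \<lambda>\<rangle>\<close>; vector entries are counted from 0, generators from 1.\<close>

definition generator_comb :: "nat \<Rightarrow> real vec \<Rightarrow> complex mat" where
  "generator_comb d n =
     sum_square_mats d {1..d\<^sup>2 - 1} (\<lambda>j. complex_of_real (n $ (j - 1)) \<cdot>\<^sub>m generator d j)"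


section \<open>Locally maximally mixed states\<close>

definition density_operator :: "nat \<Rightarrow> complex mat \<Rightarrow> bool" where
  "density_operator n \<rho> \<longleftrightarrow> psd n \<rho> \<and> tr \<rho> = 1"

definition locally_maximally_mixed :: "nat \<Rightarrow> complex mat \<Rightarrow> bool" where
  "locally_maximally_mixed d \<rho> \<longleftrightarrow> density_operator (d * d) \<rho> \<and>
     ptrace_fst d \<rho> = (1 / of_nat d) \<cdot>\<^sub>m 1\<^sub>m d \<and> ptrace_snd d \<rho> = (1 / of_nat d) \<cdot>\<^sub>m 1\<^sub>m d"

definition lmm_operator :: "nat \<Rightarrow> real mat \<Rightarrow> complex mat" where
  "lmm_operator d K = (1 / of_nat (d\<^sup>2)) \<cdot>\<^sub>m (1\<^sub>m d \<otimes>\<^sub>m 1\<^sub>m d +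
     sum_square_mats (d * d) {1..d\<^sup>2 - 1} (\<lambda>j.
       generator_comb d (K *\<^sub>v unit_vec (d\<^sup>2 - 1) (j - 1)) \<otimes>\<^sub>m
       generator_comb d (unit_vec (d\<^sup>2 - 1) (j - 1))))"

definition correlation_matrices :: "nat \<Rightarrow> real mat set" where
  "correlation_matrices d =
     {K \<in> carrier_mat (d\<^sup>2 - 1) (d\<^sup>2 - 1). psd (d * d) (lmm_operator d K)}"

definition Xi :: "nat \<Rightarrow> real mat \<Rightarrow> real" where
  "Xi d K = (\<Sum>j = d..d\<^sup>2 - 1. eigenvalues_desc (K * transpose_mat K) ! (j - 1))"


section \<open>Measurement-induced quantum discord\<close>

definition orthogonal_projector :: "nat \<Rightarrow> complex mat \<Rightarrow> bool" where
  "orthogonal_projector d P \<longleftrightarrow> P \<in> carrier_mat d d \<and> mat_adjoint P = P \<and> P * P = P"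

definition projective_measurement :: "nat \<Rightarrow> (nat \<Rightarrow> complex mat) \<Rightarrow> bool" where
  "projective_measurement d P \<longleftrightarrow>
     (\<forall>k\<in>{1..d}. orthogonal_projector d (P k) \<and> vec_space.rank d (P k) = 1) \<and>
     (\<forall>j\<in>{1..d}. \<forall>k\<in>{1..d}. j \<noteq> k \<longrightarrow> P j * P k = 0\<^sub>m d d) \<and>
     sum_square_mats d {1..d} P = 1\<^sub>m d"

text \<open>
  The map \<open>\<P> \<otimes> id\<close>, where \<open>\<P> A = (\<Sum>k. P\<^sub>k A P\<^sub>k)\<close>, has the Kraus operators \<open>P\<^sub>k \<otimes> 1\<close>.
\<close>

definition local_measurement :: "nat \<Rightarrow> (nat \<Rightarrow> complex mat) \<Rightarrow> complex mat \<Rightarrow> complex mat" where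
  "local_measurement d P \<rho> =
     sum_square_mats (d * d) {1..d} (\<lambda>k. (P k \<otimes>\<^sub>m 1\<^sub>m d) * \<rho> * (P k \<otimes>\<^sub>m 1\<^sub>m d))"

text \<open>
  The minima exist because the set of measurements is non-empty and compact and the norms are
  continuous; they are written as infima.
\<close>

definition discord1 :: "nat \<Rightarrow> complex mat \<Rightarrow> real" where
  "discord1 d \<rho> = real d / (2 * (real d - 1)) *
     (INF P\<in>{P. projective_measurement d P}. norm1 (\<rho> - local_measurement d P \<rho>))"

definition discord2 :: "nat \<Rightarrow> complex mat \<Rightarrow> real" where
  "discord2 d \<rho> = real d / (real d - 1) *
     (INF P\<in>{P. projective_measurement d P}. (norm2 (\<rho> - local_measurement d P \<rho>))\<^sup>2)"

end

theory Submission
  imports Defs "HOL-Analysis.Convex"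
begin

text \<open>
  The measurement leaves the identity component of the state invariant, and it acts on the
  matrices \<open>\<langle>K e\<^sub>j, \<lambda>\<rangle>\<close> by removing everything but their components along \<open>P\<^sub>1, \<dots>, P\<^sub>d\<close>.  With
  \<open>\<alpha>\<^sub>k = (tr (P\<^sub>k \<lambda>\<^sub>i))\<^sub>i\<close> and \<open>S = K K\<^sup>T\<close> this gives
  \<open>\<parallel>\<rho> - \<P>(\<rho>)\<parallel>\<^sub>2\<^sup>2 = 4 / d\<^sup>4 (tr S - 1/2 \<Sum>\<^sub>k \<langle>\<alpha>\<^sub>k, S \<alpha>\<^sub>k\<rangle>)\<close>.  In an orthonormal eigenbasis \<open>u\<^sub>l\<close> of \<open>S\<close> the right-hand
  side is \<open>4 / d\<^sup>4 \<Sum>\<^sub>l \<eta>\<^sub>l (1 - w\<^sub>l)\<close> with \<open>w\<^sub>l = 1/2 \<Sum>\<^sub>k \<langle>u\<^sub>l, \<alpha>\<^sub>k\<rangle>\<^sup>2\<close>.  Bessel's inequality for the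
  projectors yields \<open>w\<^sub>l \<le> 1\<close>, and Bessel's inequality for the identity and the generators yields
  \<open>\<Sum>\<^sub>l w\<^sub>l \<le> d - 1\<close>; so at best the \<open>d - 1\<close> largest eigenvalues are cancelled.  The bound for the
  trace norm follows from \<open>\<parallel>A\<parallel>\<^sub>2 \<le> \<parallel>A\<parallel>\<^sub>1\<close>, and if \<open>\<eta>\<^sub>d, \<eta>\<^sub>d\<^sub>+\<^sub>1, \<dots>\<close> all vanish, then \<open>K\<close> has rank at most \<open>d - 1\<close>.
\<close>

section \<open>The spectral theorem for Hermitian matrices\<close>

lemma mat_adjoint_dim [simp]:
  "dim_row (mat_adjoint A) = dim_col A" "dim_col (mat_adjoint A) = dim_row A"
  unfolding mat_adjoint_def by auto

lemma mat_adjoint_carrier [simp]: "A \<in> carrier_mat n m \<Longrightarrow> mat_adjoint A \<in> carrier_mat m n"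
  by (auto intro!: carrier_matI)

lemma mat_adjoint_index [simp]:
  "i < dim_col A \<Longrightarrow> j < dim_row A \<Longrightarrow> mat_adjoint A $$ (i, j) = conjugate (A $$ (j, i))"
  unfolding mat_adjoint_def by (simp add: mat_of_rows_index)

lemma mat_adjoint_adjoint [simp]:
  "mat_adjoint (mat_adjoint A) = A"
  by (rule eq_matI) auto

lemma mat_adjoint_mult:
  fixes A :: "'a :: conjugatable_field mat"
  assumes "A \<in> carrier_mat n m" "B \<in> carrier_mat m l"
  shows "mat_adjoint (A * B) = mat_adjoint B * mat_adjoint A"
proof (rule eq_matI)
  fix i j assume "i < dim_row (mat_adjoint B * mat_adjoint A)" "j < dim_col (mat_adjoint B * mat_adjoint A)"
  then show "mat_adjoint (A * B) $$ (i, j) = (mat_adjoint B * mat_adjoint A) $$ (i, j)"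
    using assms by (auto simp: scalar_prod_def sum_conjugate conjugate_dist_mul mult.commute intro!: sum.cong)
qed (use assms in auto)

lemma conjugate_one [simp]: "conjugate 1 = (1 :: 'a :: conjugatable_field)"
proof -
  have "conjugate (conjugate (1 :: 'a)) = conjugate (1 * conjugate 1)" by simp
  also have "\<dots> = conjugate 1 * conjugate (conjugate 1)" by (simp only: conjugate_dist_mul)
  finally show ?thesis by simp
qed

lemma mat_adjoint_mult_index:
  fixes A :: "'a :: conjugatable_field mat"
  assumes "A \<in> carrier_mat n m" "B \<in> carrier_mat n l" "i < m" "j < l"
  shows "(mat_adjoint A * B) $$ (i, j) = (\<Sum>k<n. conjugate (A $$ (k, i)) * B $$ (k, j))"
  using assms by (auto simp: scalar_prod_def atLeast0LessThan)

text \<open>Complete \<open>v\<close> to a basis and apply Gram-Schmidt, which leaves the first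
  vector unchanged; dividing each vector by a \<open>c\<close> with \<open>c * conjugate c\<close>
  equal to its squared length makes the basis orthonormal. This splits an eigenvector off a
  Hermitian matrix.\<close>

lemma unitary_first_column:
  fixes v :: "'a :: conjugatable_ordered_field vec"
  assumes v: "v \<in> carrier_vec n" "v \<noteq> 0\<^sub>v n"
    and root: "\<And>x :: 'a. 0 < x \<Longrightarrow> \<exists>c. c * conjugate c = x"
  shows "\<exists>W c. W \<in> carrier_mat n n \<and> mat_adjoint W * W = 1\<^sub>m n \<and> col W 0 = c \<cdot>\<^sub>v v"
proof -
  interpret cof_vec_space n "TYPE('a)" .
  define b where "b = basis_completion v"
  define ws where "ws = gram_schmidt n b"
  note bc = basis_completion[OF v, folded b_def]
  have n: "n \<noteq> 0" using v by auto
  from bc(6,7) n obtain vs where bv: "b = v # vs" by (cases b) auto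
  from gram_schmidt_result[OF bc(2,4,5) refl, folded ws_def]
  have ws: "set ws \<subseteq> carrier_vec n" "corthogonal ws" "length ws = n"
    by (auto simp: bc)
  have hdws: "ws ! 0 = v"
    using gram_schmidt_hd[OF v(1), of vs, folded bv] ws(3) n unfolding ws_def
    by (metis hd_conv_nth length_0_conv)
  have wc: "ws ! i \<in> carrier_vec n" if "i < n" for i
    using ws that by auto
  have "\<exists>c. c * conjugate c = ws ! i \<bullet>c ws ! i" if "i < n" for i
  proof (rule root)
    have "ws ! i \<bullet>c ws ! i \<noteq> 0"
      using corthogonalD[OF ws(2), of i i] that ws(3) by simp
    then show "0 < ws ! i \<bullet>c ws ! i"
      using conjugate_square_ge_0_vec[of "ws ! i"] by (simp add: order.strict_iff_order)
  qed
  then obtain c where c: "\<And>i. i < n \<Longrightarrow> c i * conjugate (c i) = ws ! i \<bullet>c ws ! i" by metis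
  define W where "W = mat n n (\<lambda>(i, j). inverse (c j) * ws ! j $ i)"
  have W: "W \<in> carrier_mat n n" unfolding W_def by simp
  have cnz: "c i \<noteq> 0" if "i < n" for i
    using c[OF that] corthogonalD[OF ws(2), of i i] that ws(3) by auto
  have ci: "conjugate (inverse (c i)) = inverse (conjugate (c i))" if "i < n" for i
  proof -
    have "conjugate (inverse (c i)) * conjugate (c i) = 1"
      using cnz[OF that] by (simp flip: conjugate_dist_mul)
    then show ?thesis by (metis inverse_unique mult.commute)
  qed
  have "mat_adjoint W * W = 1\<^sub>m n"
  proof (rule eq_matI)
    fix i j assume "i < dim_row (1\<^sub>m n :: 'a mat)" "j < dim_col (1\<^sub>m n :: 'a mat)"
    then have ij: "i < n" "j < n" by auto
    have "(mat_adjoint W * W) $$ (i, j) = inverse (conjugate (c i)) * inverse (c j) * (ws ! j \<bullet>c ws ! i)"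
      using W ij wc[OF ij(1)] wc[OF ij(2)] ci[OF ij(1)]
      by (subst mat_adjoint_mult_index[OF W W ij])
        (auto simp: W_def scalar_prod_def sum_distrib_left conjugate_dist_mul atLeast0LessThan ac_simps intro!: sum.cong)
    also have "\<dots> = 1\<^sub>m n $$ (i, j)"
      using corthogonalD[OF ws(2), of j i] ij ws(3) c[OF ij(1)] cnz[OF ij(1)]
      by (cases "i = j") (auto simp: field_simps simp flip: c)
    finally show "(mat_adjoint W * W) $$ (i, j) = 1\<^sub>m n $$ (i, j)" .
  qed (use W in auto)
  moreover have "col W 0 = inverse (c 0) \<cdot>\<^sub>v v"
    using n v hdws by (intro eq_vecI) (auto simp: W_def)
  ultimately show ?thesis using W by blast
qed

text \<open>The hypothesis \<open>root\<close> holds for the real and the complex numbers; it is what normalising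
  an eigenvector needs.\<close>

lemma hermitian_diagonalization:
  fixes A :: "'a :: conjugatable_ordered_field mat"
  assumes root: "\<And>x :: 'a. 0 < x \<Longrightarrow> \<exists>c. c * conjugate c = x"
    and "A \<in> carrier_mat n n" "mat_adjoint A = A" "char_poly A = (\<Prod>e\<leftarrow>es. [:- e, 1:])"
  shows "\<exists>U. U \<in> carrier_mat n n \<and> mat_adjoint U * U = 1\<^sub>m n
    \<and> A = U * mat n n (\<lambda>(i, j). if i = j then es ! i else 0) * mat_adjoint U"
  using assms(2-4)
proof (induction es arbitrary: n A)
  case Nil
  then have "n = 0" using degree_monic_char_poly[of A n] by auto
  then show ?case using Nil by (intro exI[of _ "1\<^sub>m n"]) auto
next
  case (Cons e es n A)
  note A = \<open>A \<in> carrier_mat n n\<close>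
  define m where "m = n - 1"
  have "degree (char_poly A) = n" using degree_monic_char_poly[OF A] by auto
  moreover have "degree (\<Prod>e\<leftarrow>e # es. [:- e, 1:]) = Suc (length es)"
  proof -
    have "degree (\<Prod>e\<leftarrow>es. [:- e, 1:]) = length es" for es :: "'a list"
      by (rule degree_linear_factors)
    from this[of "e # es"] show ?thesis by simp
  qed
  ultimately have n: "n = Suc m" "m = length es" unfolding m_def using Cons.prems(3) by auto
  have "eigenvalue A e"
    unfolding eigenvalue_root_char_poly[OF A] Cons.prems(3) by simp
  then obtain v where v: "v \<in> carrier_vec n" "v \<noteq> 0\<^sub>v n" and Av: "A *\<^sub>v v = e \<cdot>\<^sub>v v"
    using A unfolding eigenvalue_def eigenvector_def by auto
  obtain W c where W: "W \<in> carrier_mat n n" and WW: "mat_adjoint W * W = 1\<^sub>m n" and W0: "col W 0 = c \<cdot>\<^sub>v v"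
    using unitary_first_column[OF v root] by blast
  let ?W = "mat_adjoint W"
  have W': "?W \<in> carrier_mat n n" using W by simp
  have WW': "W * ?W = 1\<^sub>m n" by (rule mat_mult_left_right_inverse[OF W' W WW])
  \<comment> \<open>The first column of \<open>W\<close> is an eigenvector, so the first column of
    \<open>B\<close> is \<open>e\<close> times the first unit vector. Since \<open>B\<close> is
    Hermitian, its first row also vanishes off the diagonal, and \<open>B\<close> splits into the
    blocks \<open>e\<close> and \<open>C\<close>.\<close>
  define B where "B = ?W * A * W"
  have B: "B \<in> carrier_mat n n" unfolding B_def using W W' A by auto
  have hB: "mat_adjoint B = B"
    unfolding B_def using W W' A Cons.prems(2)
    by (simp add: mat_adjoint_mult[of _ n n _ n] assoc_mult_mat[of _ n n _ n _ n] mult_carrier_mat[of _ n n _ n])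
  have col_W: "col W 0 \<in> carrier_vec n" using W by auto
  have "col B 0 = ?W *\<^sub>v (A *\<^sub>v col W 0)"
    unfolding B_def using W W' A n by (auto simp: assoc_mult_mat[of _ n n _ n _ n] col_mult2[of _ n n _ n] mult_mat_vec_def)
  also have "A *\<^sub>v col W 0 = e \<cdot>\<^sub>v col W 0"
    unfolding W0 using v A Av by (simp add: mult_mat_vec[of _ n n] smult_smult_assoc mult.commute)
  also have "?W *\<^sub>v (e \<cdot>\<^sub>v col W 0) = e \<cdot>\<^sub>v col (?W * W) 0"
    using mult_mat_vec[OF W' col_W, of e] col_mult2[OF W' W, of 0] n by simp
  finally have col0: "col B 0 = e \<cdot>\<^sub>v unit_vec n 0" unfolding WW using n by simp
  have B0: "B $$ (i, 0) = (if i = 0 then e else 0)" if "i < n" for i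
    using arg_cong[OF col0, of "\<lambda>v. v $ i"] that B n by auto
  have B0': "B $$ (0, i) = (if i = 0 then e else 0)" if "i < n" for i
    using arg_cong[OF hB, of "\<lambda>M. M $$ (0, i)"] that B n B0[OF that] B0[of 0] by (auto split: if_splits)
  define C where "C = mat m m (\<lambda>(i, j). B $$ (Suc i, Suc j))"
  have C: "C \<in> carrier_mat m m" unfolding C_def by simp
  define E where "E = mat 1 1 (\<lambda>_. e)"
  have E: "E \<in> carrier_mat 1 1" unfolding E_def by simp
  have Bblock: "B = four_block_mat E (0\<^sub>m 1 m) (0\<^sub>m m 1) C"
    by (rule eq_matI) (use B n B0 B0' in \<open>auto simp: E_def C_def\<close>)
  have hC: "mat_adjoint C = C"
  proof (rule eq_matI)
    fix i j assume "i < dim_row C" "j < dim_col C"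
    then show "mat_adjoint C $$ (i, j) = C $$ (i, j)"
      using arg_cong[OF hB, of "\<lambda>M. M $$ (Suc i, Suc j)"] B n by (auto simp: C_def)
  qed (use C in auto)
  have sim: "similar_mat B A"
    unfolding similar_mat_def
    by (intro exI[of _ ?W] exI[of _ W] similar_mat_witI[of _ _ n] WW WW' B A W W' B_def)
  \<comment> \<open>Cancelling the linear factor that belongs to \<open>e\<close> leaves exactly the
    list \<open>es\<close> for the smaller block, which is what the induction hypothesis asks
    for.\<close>
  have "char_poly E * char_poly C = [:- e, 1:] * (\<Prod>e\<leftarrow>es. [:- e, 1:])"
    using char_poly_similar[OF sim] Cons.prems(3)
      char_poly_four_block_zeros_col[OF E zero_carrier_mat C] unfolding Bblock by simp
  moreover have "char_poly E = [:- e, 1:]"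
    by (simp add: E_def char_poly_defs det_def sign_def)
  ultimately have "char_poly C = (\<Prod>e\<leftarrow>es. [:- e, 1:])"
    by (metis mult_cancel_left pCons_eq_0_iff zero_neq_one)
  from Cons.IH[OF C hC this] obtain P where P: "P \<in> carrier_mat m m" and PP: "mat_adjoint P * P = 1\<^sub>m m"
    and CP: "C = P * mat m m (\<lambda>(i, j). if i = j then es ! i else 0) * mat_adjoint P" by blast
  let ?D = "mat m m (\<lambda>(i, j). if i = j then es ! i else 0)"
  let ?D' = "mat n n (\<lambda>(i, j). if i = j then (e # es) ! i else 0)"
  \<comment> \<open>\<open>R\<close> lets the unitary of the smaller block act on all coordinates
    but the first; \<open>W * R\<close> is then the unitary sought for \<open>A\<close>.\<close>
  define R where "R = four_block_mat (1\<^sub>m 1) (0\<^sub>m 1 m) (0\<^sub>m m 1) P"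
  have R: "R \<in> carrier_mat n n" unfolding R_def using P n by auto
  have R': "mat_adjoint R = four_block_mat (1\<^sub>m 1) (0\<^sub>m 1 m) (0\<^sub>m m 1) (mat_adjoint P)"
    by (rule eq_matI) (use P R n in \<open>auto simp: R_def\<close>)
  have D': "?D' = four_block_mat E (0\<^sub>m 1 m) (0\<^sub>m m 1) ?D"
    by (rule eq_matI) (use n in \<open>auto simp: E_def\<close>)
  note mb = mult_four_block_mat[of _ 1 1 _ m _ m _ _ 1 _ m]
  have RR: "mat_adjoint R * R = 1\<^sub>m n"
    unfolding R' unfolding R_def using P PP n by (subst mb) auto
  have RB: "R * ?D' * mat_adjoint R = B"
    unfolding D' R' Bblock unfolding R_def using P n C E CP[symmetric]
    by (simp add: mb[OF _ _ _ _ E] mb)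
  have "W * B * ?W = (W * ?W) * A * (W * ?W)"
    unfolding B_def using W W' A
    by (simp add: assoc_mult_mat[of _ n n _ n _ n] mult_carrier_mat[of _ n n _ n])
  then have "A = W * (R * ?D' * mat_adjoint R) * ?W" using A unfolding WW' RB by simp
  also have "\<dots> = W * R * ?D' * mat_adjoint (W * R)"
    using W W' R by (simp add: mat_adjoint_mult[of _ n n _ n] assoc_mult_mat[of _ n n _ n _ n] mult_carrier_mat[of _ n n _ n])
  finally have AU: "A = W * R * ?D' * mat_adjoint (W * R)" .
  have "mat_adjoint (W * R) * (W * R) = mat_adjoint R * (?W * W) * R"
    using W W' R by (simp add: mat_adjoint_mult[of _ n n _ n] assoc_mult_mat[of _ n n _ n _ n] mult_carrier_mat[of _ n n _ n])
  then have "mat_adjoint (W * R) * (W * R) = 1\<^sub>m n"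
    unfolding WW using R RR by simp
  with AU show ?case using W R by (intro exI[of _ "W * R"]) auto
qed

text \<open>Columns are orthonormal by hypothesis. A left inverse of a square matrix is also a right
  inverse, so the rows are orthonormal too; this is the completeness relation of the column
  basis.\<close>

lemma unitary_column_entries:
  fixes U :: "'a :: conjugatable_field mat"
  assumes U: "U \<in> carrier_mat n n" and UU: "mat_adjoint U * U = 1\<^sub>m n" and ij: "i < n" "j < n"
  shows "(\<Sum>k<n. conjugate (U $$ (k, i)) * U $$ (k, j)) = (if i = j then 1 else 0)"
    and "(\<Sum>k<n. U $$ (i, k) * conjugate (U $$ (j, k))) = (if i = j then 1 else 0)"
proof -
  show "(\<Sum>k<n. conjugate (U $$ (k, i)) * U $$ (k, j)) = (if i = j then 1 else 0)"
    unfolding mat_adjoint_mult_index[OF U U ij, symmetric] UU using ij by simp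
  have "U * mat_adjoint U = 1\<^sub>m n"
    using mat_mult_left_right_inverse[OF mat_adjoint_carrier[OF U] U UU] .
  from arg_cong[OF this, of "\<lambda>M. M $$ (i, j)"]
  show "(\<Sum>k<n. U $$ (i, k) * conjugate (U $$ (j, k))) = (if i = j then 1 else 0)"
    using U ij by (simp add: scalar_prod_def atLeast0LessThan)
qed

lemma index_mult_diag_adjoint:
  fixes U :: "'a :: conjugatable_field mat"
  assumes U: "U \<in> carrier_mat n n" and ij: "i < n" "j < n"
  shows "(U * mat n n (\<lambda>(i, j). if i = j then e i else 0) * mat_adjoint U) $$ (i, j)
    = (\<Sum>k<n. U $$ (i, k) * e k * conjugate (U $$ (j, k)))"
proof -
  let ?D = "mat n n (\<lambda>(i, j). if i = j then e i else 0)"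
  have "(U * ?D) $$ (i, k) = U $$ (i, k) * e k" if "k < n" for k
  proof -
    have "(U * ?D) $$ (i, k) = (\<Sum>l<n. if l = k then U $$ (i, l) * e l else 0)"
      using U ij that
      by (simp add: scalar_prod_def atLeast0LessThan if_distrib[of "(*) _"] cong: if_cong)
    then show ?thesis using that by simp
  qed
  then show ?thesis
    using U ij by (auto simp: scalar_prod_def atLeast0LessThan simp del: index_mult_mat(1) simp: index_mult_mat(1)[of _ "U * ?D"] intro!: sum.cong)
qed

text \<open>Entrywise form of the diagonalization, suited to rearranging finite sums. The
  eigenvalues appear in the order of the given list, so the decreasing list of eigenvalues can be
  fed in directly.\<close>

lemma hermitian_spectral:
  fixes A :: "'a :: conjugatable_ordered_field mat"
  assumes "\<And>x :: 'a. 0 < x \<Longrightarrow> \<exists>c. c * conjugate c = x"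
    and "A \<in> carrier_mat n n" "mat_adjoint A = A" "char_poly A = (\<Prod>e\<leftarrow>es. [:- e, 1:])"
  obtains U where "U \<in> carrier_mat n n" "mat_adjoint U * U = 1\<^sub>m n"
    "\<And>i j. i < n \<Longrightarrow> j < n \<Longrightarrow> A $$ (i, j) = (\<Sum>k<n. U $$ (i, k) * es ! k * conjugate (U $$ (j, k)))"
proof -
  from hermitian_diagonalization[OF assms] obtain U where U: "U \<in> carrier_mat n n"
    "mat_adjoint U * U = 1\<^sub>m n"
    and A: "A = U * mat n n (\<lambda>(i, j). if i = j then es ! i else 0) * mat_adjoint U" by blast
  show ?thesis
    by (rule that[OF U]) (subst A, rule index_mult_diag_adjoint[OF U(1)])
qed

lemma complex_pos_norm_sq: "0 < x \<Longrightarrow> \<exists>c :: complex. c * conjugate c = x"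
  by (rule exI[of _ "complex_of_real (sqrt (Re x))"])
    (auto simp: less_complex_def complex_eq_iff)

lemma real_pos_norm_sq: "0 < x \<Longrightarrow> \<exists>c :: real. c * conjugate c = x"
  by (rule exI[of _ "sqrt x"]) auto

lemma hermitian_spectral_complex:
  fixes A :: "complex mat"
  assumes A: "A \<in> carrier_mat n n" "mat_adjoint A = A"
  obtains U e where "U \<in> carrier_mat n n" "mat_adjoint U * U = 1\<^sub>m n"
    "char_poly A = (\<Prod>k\<leftarrow>[0..<n]. [:- e k, 1:])"
    "\<And>i j. i < n \<Longrightarrow> j < n \<Longrightarrow> A $$ (i, j) = (\<Sum>k<n. U $$ (i, k) * e k * cnj (U $$ (j, k)))"
proof -
  from char_poly_factorized[OF A(1)] obtain es where es: "char_poly A = (\<Prod>e\<leftarrow>es. [:- e, 1:])" "length es = n"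
    by auto
  from hermitian_spectral[OF complex_pos_norm_sq A es(1)] obtain U where U: "U \<in> carrier_mat n n"
    "mat_adjoint U * U = 1\<^sub>m n"
    "\<And>i j. i < n \<Longrightarrow> j < n \<Longrightarrow> A $$ (i, j) = (\<Sum>k<n. U $$ (i, k) * es ! k * conjugate (U $$ (j, k)))"
    by blast
  have "map (\<lambda>k. [:- (es ! k), 1:]) [0..<n] = map (\<lambda>e. [:- e, 1:]) es"
    using es(2) by (intro nth_equalityI) auto
  then show ?thesis using U es that[of U "\<lambda>k. es ! k"] by simp
qed

section \<open>Quadratic forms and reality of the eigenvalues\<close>

lemma sum_rotate:
  "(\<Sum>i\<in>A. \<Sum>j\<in>B. \<Sum>k\<in>C. f i j k) = (\<Sum>k\<in>C. \<Sum>i\<in>A. \<Sum>j\<in>B. f i j k)"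
proof -
  have "(\<Sum>i\<in>A. \<Sum>j\<in>B. \<Sum>k\<in>C. f i j k) = (\<Sum>i\<in>A. \<Sum>k\<in>C. \<Sum>j\<in>B. f i j k)"
    by (intro sum.cong refl sum.swap)
  also have "\<dots> = (\<Sum>k\<in>C. \<Sum>i\<in>A. \<Sum>j\<in>B. f i j k)"
    by (rule sum.swap)
  finally show ?thesis .
qed

lemma quadratic_form_entries:
  assumes "A \<in> carrier_mat n n" "v \<in> carrier_vec n"
  shows "(A *\<^sub>v v) \<bullet>c v = (\<Sum>i<n. \<Sum>j<n. A $$ (i, j) * v $ j * cnj (v $ i))"
  using assms by (auto simp: scalar_prod_def atLeast0LessThan sum_distrib_right intro!: sum.cong)

lemma quadratic_form_spectral:
  assumes U: "U \<in> carrier_mat n n" and A: "A \<in> carrier_mat n n"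
    and Ae: "\<And>i j. i < n \<Longrightarrow> j < n \<Longrightarrow> A $$ (i, j) = (\<Sum>k<n. U $$ (i, k) * e k * cnj (U $$ (j, k)))"
    and v: "v \<in> carrier_vec n"
  shows "(A *\<^sub>v v) \<bullet>c v = (\<Sum>k<n. e k * of_real ((cmod (\<Sum>j<n. cnj (U $$ (j, k)) * v $ j))\<^sup>2))"
proof -
  have "(A *\<^sub>v v) \<bullet>c v = (\<Sum>i<n. \<Sum>j<n. \<Sum>k<n. U $$ (i, k) * e k * cnj (U $$ (j, k)) * v $ j * cnj (v $ i))"
    unfolding quadratic_form_entries[OF A v] by (simp add: Ae sum_distrib_right)
  also have "\<dots> = (\<Sum>k<n. \<Sum>i<n. \<Sum>j<n. U $$ (i, k) * e k * cnj (U $$ (j, k)) * v $ j * cnj (v $ i))"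
    by (rule sum_rotate)
  also have "\<dots> = (\<Sum>k<n. e k * ((\<Sum>j<n. cnj (U $$ (j, k)) * v $ j) * cnj (\<Sum>j<n. cnj (U $$ (j, k)) * v $ j)))"
    by (intro sum.cong refl) (simp add: sum_product sum_distrib_left ac_simps)
  finally show ?thesis by (simp add: complex_norm_square del: of_real_power)
qed

text \<open>At the \<open>k\<close>-th column of \<open>U\<close> the quadratic form collapses to
  \<open>e k\<close> by orthonormality. Conjugating that double sum only swaps its two indices
  because \<open>A\<close> is Hermitian, so the value is real.\<close>

lemma hermitian_eigenvalue_real:
  assumes A: "A \<in> carrier_mat n n" "mat_adjoint A = A" and U: "U \<in> carrier_mat n n" "mat_adjoint U * U = 1\<^sub>m n"
    and Ae: "\<And>i j. i < n \<Longrightarrow> j < n \<Longrightarrow> A $$ (i, j) = (\<Sum>k<n. U $$ (i, k) * e k * cnj (U $$ (j, k)))"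
    and k: "k < n"
  shows "e k = (A *\<^sub>v col U k) \<bullet>c col U k" and "e k \<in> \<real>"
proof -
  have "(A *\<^sub>v col U k) \<bullet>c col U k = (\<Sum>l<n. e l * of_real ((cmod (if l = k then 1 else 0))\<^sup>2))"
    using unitary_column_entries(1)[OF U] k U(1)
    by (subst quadratic_form_spectral[OF U(1) A(1) Ae]) (auto intro!: sum.cong)
  also have "\<dots> = (\<Sum>l<n. if l = k then e l else 0)" by (intro sum.cong) auto
  finally show 1: "e k = (A *\<^sub>v col U k) \<bullet>c col U k" using k by simp
  have col: "col U k \<in> carrier_vec n" using U(1) by auto
  have "cnj (e k) = (\<Sum>i<n. \<Sum>j<n. A $$ (j, i) * cnj (col U k $ j) * col U k $ i)"
  proof -
    have "cnj (A $$ (i, j)) = A $$ (j, i)" if "i < n" "j < n" for i j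
      using arg_cong[OF A(2), of "\<lambda>M. M $$ (j, i)"] A(1) that by simp
    then show ?thesis
      unfolding 1 quadratic_form_entries[OF A(1) col] by (auto intro!: sum.cong)
  qed
  also have "\<dots> = e k"
    unfolding 1 quadratic_form_entries[OF A(1) col]
    by (subst sum.swap) (simp add: ac_simps)
  finally show "e k \<in> \<real>" by (simp add: Reals_cnj_iff)
qed

section \<open>Square roots of positive semidefinite matrices\<close>

lemma psdD:
  assumes "psd n A"
  shows "A \<in> carrier_mat n n" "mat_adjoint A = A" "\<And>v. v \<in> carrier_vec n \<Longrightarrow> 0 \<le> (A *\<^sub>v v) \<bullet>c v"
  using assms unfolding psd_def by auto

lemma psd_spectral:
  assumes U: "U \<in> carrier_mat n n" and A: "A \<in> carrier_mat n n"
    and Ae: "\<And>i j. i < n \<Longrightarrow> j < n \<Longrightarrow> A $$ (i, j) = (\<Sum>k<n. U $$ (i, k) * of_real (e k) * cnj (U $$ (j, k)))"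
    and e: "\<And>k. k < n \<Longrightarrow> 0 \<le> e k"
  shows "psd n A"
  unfolding psd_def
proof (intro conjI ballI A)
  show "mat_adjoint A = A"
    by (rule eq_matI) (use A in \<open>auto simp: Ae ac_simps intro!: sum.cong\<close>)
  fix v :: "complex vec" assume v: "v \<in> carrier_vec n"
  show "0 \<le> (A *\<^sub>v v) \<bullet>c v"
    using quadratic_form_spectral[OF U A Ae v]
    by (simp del: of_real_power, intro sum_nonneg) (use e in \<open>auto simp: less_eq_complex_def simp flip: of_real_mult of_real_power\<close>)
qed

text \<open>Keep the eigenbasis and replace the eigenvalues by their square roots. They are
  non-negative because each is a value of the quadratic form; in \<open>B * B\<close> the mixed
  terms vanish by orthonormality.\<close>

lemma psd_sqrt_exists:
  assumes "psd n A"
  obtains B where "psd n B" "B * B = A"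
proof -
  note A = psdD[OF assms]
  from hermitian_spectral_complex[OF A(1,2)] obtain U e where U: "U \<in> carrier_mat n n" "mat_adjoint U * U = 1\<^sub>m n"
    and Ae: "\<And>i j. i < n \<Longrightarrow> j < n \<Longrightarrow> A $$ (i, j) = (\<Sum>k<n. U $$ (i, k) * e k * cnj (U $$ (j, k)))"
    by metis
  have e: "e k \<ge> 0" if "k < n" for k
    using A(3)[of "col U k"] hermitian_eigenvalue_real(1)[OF A(1,2) U Ae that] U(1) by auto
  define s where "s k = sqrt (Re (e k))" for k
  have s: "e k = of_real (s k * s k)" "0 \<le> s k" if "k < n" for k
    using e[OF that] by (auto simp: s_def less_eq_complex_def complex_eq_iff)
  define B where "B = mat n n (\<lambda>(i, j). \<Sum>k<n. U $$ (i, k) * of_real (s k) * cnj (U $$ (j, k)))"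
  have B: "B \<in> carrier_mat n n" unfolding B_def by simp
  have Be: "B $$ (i, j) = (\<Sum>k<n. U $$ (i, k) * of_real (s k) * cnj (U $$ (j, k)))" if "i < n" "j < n" for i j
    using that unfolding B_def by simp
  have "B * B = A"
  proof (rule eq_matI)
    fix i j assume "i < dim_row A" "j < dim_col A"
    then have ij: "i < n" "j < n" using A by auto
    have "(B * B) $$ (i, j) = (\<Sum>l<n. \<Sum>k<n. \<Sum>m<n.
      U $$ (i, k) * of_real (s k) * cnj (U $$ (l, k)) * (U $$ (l, m) * of_real (s m) * cnj (U $$ (j, m))))"
      using B ij by (auto simp: scalar_prod_def atLeast0LessThan Be sum_product intro!: sum.cong)
    also have "\<dots> = (\<Sum>k<n. \<Sum>m<n. \<Sum>l<n.
      U $$ (i, k) * of_real (s k) * cnj (U $$ (l, k)) * (U $$ (l, m) * of_real (s m) * cnj (U $$ (j, m))))"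
      by (rule sum_rotate[symmetric])
    also have "\<dots> = (\<Sum>k<n. \<Sum>m<n. U $$ (i, k) * of_real (s k) * of_real (s m) * cnj (U $$ (j, m)) *
      (\<Sum>l<n. conjugate (U $$ (l, k)) * U $$ (l, m)))"
      by (intro sum.cong refl) (simp add: sum_distrib_left ac_simps)
    also have "\<dots> = (\<Sum>k<n. \<Sum>m<n. if k = m then U $$ (i, k) * e k * cnj (U $$ (j, k)) else 0)"
      by (intro sum.cong refl) (subst unitary_column_entries(1)[OF U], auto simp: s)
    also have "\<dots> = A $$ (i, j)" using ij by (simp add: Ae)
    finally show "(B * B) $$ (i, j) = A $$ (i, j)" .
  qed (use A B in auto)
  moreover have "psd n B" by (rule psd_spectral[OF U(1) B Be s(2)])
  ultimately show ?thesis using that by blast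
qed

section \<open>Traces and norms\<close>

lemma tr_comm:
  fixes A :: "'a :: comm_semiring_0 mat"
  assumes "A \<in> carrier_mat n m" "B \<in> carrier_mat m n"
  shows "tr (A * B) = tr (B * A)"
proof -
  have "tr (A * B) = (\<Sum>i<n. \<Sum>j<m. A $$ (i, j) * B $$ (j, i))"
    using assms by (auto simp: tr_def scalar_prod_def atLeast0LessThan intro!: sum.cong)
  also have "\<dots> = tr (B * A)"
    using assms by (subst sum.swap) (auto simp: tr_def scalar_prod_def atLeast0LessThan ac_simps intro!: sum.cong)
  finally show ?thesis .
qed

lemma tr_add:
  "A \<in> carrier_mat n n \<Longrightarrow> B \<in> carrier_mat n n \<Longrightarrow> tr (A + B) = tr A + tr B"
  by (auto simp: tr_def sum.distrib)

lemma tr_adjoint_mult_self: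
  fixes A :: "complex mat"
  assumes "A \<in> carrier_mat n m"
  shows "tr (mat_adjoint A * A) = of_real (\<Sum>i<m. \<Sum>j<n. (cmod (A $$ (j, i)))\<^sup>2)"
proof -
  have "tr (mat_adjoint A * A) = (\<Sum>i<m. \<Sum>j<n. cnj (A $$ (j, i)) * A $$ (j, i))"
    using assms by (auto simp: tr_def scalar_prod_def atLeast0LessThan intro!: sum.cong)
  then show ?thesis by (simp add: complex_norm_square mult.commute del: of_real_power)
qed

lemma adjoint_mult_self_tr_eq_0:
  fixes A :: "complex mat"
  assumes A: "A \<in> carrier_mat n m" and "tr (mat_adjoint A * A) = 0"
  shows "A = 0\<^sub>m n m"
proof -
  have "(\<Sum>i<m. \<Sum>j<n. (cmod (A $$ (j, i)))\<^sup>2) = 0"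
    using assms by (simp add: tr_adjoint_mult_self[OF A] del: of_real_sum)
  then have "\<forall>i<m. \<forall>j<n. A $$ (j, i) = 0"
    by (subst (asm) sum_nonneg_eq_0_iff) (auto simp: sum_nonneg sum_nonneg_eq_0_iff)
  then show ?thesis using A by (intro eq_matI) auto
qed

text \<open>The quadratic form at \<open>v\<close> is the squared length of
  \<open>A *\<^sub>v v\<close>.\<close>

lemma psd_adjoint_mult_self:
  assumes A: "A \<in> carrier_mat n m"
  shows "psd m (mat_adjoint A * A)"
  unfolding psd_def
proof (intro conjI ballI)
  show "mat_adjoint A * A \<in> carrier_mat m m" using A by auto
  show "mat_adjoint (mat_adjoint A * A) = mat_adjoint A * A"
    using A by (simp add: mat_adjoint_mult[of _ m n _ m])
  fix v :: "complex vec" assume v: "v \<in> carrier_vec m"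
  have "((mat_adjoint A * A) *\<^sub>v v) \<bullet>c v
    = (\<Sum>i<m. \<Sum>j<m. \<Sum>k<n. cnj (A $$ (k, i)) * A $$ (k, j) * v $ j * cnj (v $ i))"
    using A v by (subst quadratic_form_entries[of _ m])
      (auto simp: scalar_prod_def atLeast0LessThan sum_distrib_right intro!: sum.cong)
  also have "\<dots> = (\<Sum>k<n. \<Sum>i<m. \<Sum>j<m. cnj (A $$ (k, i)) * A $$ (k, j) * v $ j * cnj (v $ i))"
    by (rule sum_rotate)
  also have "\<dots> = (\<Sum>k<n. (\<Sum>j<m. A $$ (k, j) * v $ j) * cnj (\<Sum>j<m. A $$ (k, j) * v $ j))"
    by (intro sum.cong refl, subst sum.swap) (simp add: sum_product mult.commute mult.left_commute)
  also have "\<dots> = of_real (\<Sum>k<n. (cmod (\<Sum>j<m. A $$ (k, j) * v $ j))\<^sup>2)"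
    by (simp add: complex_norm_square del: of_real_power)
  finally show "0 \<le> ((mat_adjoint A * A) *\<^sub>v v) \<bullet>c v"
    by (simp add: less_eq_complex_def sum_nonneg del: of_real_sum)
qed

text \<open>Gram form of positivity: the entries of \<open>B\<close> become inner products of
  columns of \<open>S\<close>, and the trace of \<open>D * B * D\<close> with Hermitian
  \<open>D\<close> becomes a sum of squares.\<close>

lemma psd_square:
  assumes "psd n B" obtains S where "psd n S" "B = mat_adjoint S * S"
proof -
  from psd_sqrt_exists[OF assms] obtain S where "psd n S" "S * S = B" .
  then show ?thesis using that[of S] psdD(2)[of n S] by simp
qed

text \<open>With \<open>D = B - C\<close>, the equation \<open>B\<^sup>2 = C\<^sup>2\<close> says \<open>B D + D C = 0\<close>, so the two non-negative
  numbers \<open>tr (D B D)\<close> and \<open>tr (D C D)\<close> add up to \<open>0\<close>; hence \<open>D B D = D C D = 0\<close> and \<open>D\<^sup>3 = 0\<close>.\<close>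

lemma psd_sqrt_unique:
  assumes B: "psd n B" and C: "psd n C" and BC: "B * B = C * C"
  shows "B = C"
proof -
  note Bc = psdD(1,2)[OF B] and Cc = psdD(1,2)[OF C]
  define D where "D = B - C"
  have D: "D \<in> carrier_mat n n" unfolding D_def using Bc Cc by auto
  have hD: "mat_adjoint D = D"
  proof (rule eq_matI)
    fix i j assume "i < dim_row D" "j < dim_col D"
    then have "i < n" "j < n" using D by auto
    then show "mat_adjoint D $$ (i, j) = D $$ (i, j)"
      using arg_cong[OF Bc(2), of "\<lambda>M. M $$ (i, j)"] arg_cong[OF Cc(2), of "\<lambda>M. M $$ (i, j)"] Bc(1) Cc(1)
      by (simp add: D_def)
  qed (use D in auto)
  note as = assoc_mult_mat[of _ n n _ n _ n] mult_carrier_mat[of _ n n _ n]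
  note cs = Bc(1) Cc(1) D
  obtain S where S: "psd n S" "B = mat_adjoint S * S" using psd_square[OF B] .
  obtain T where T: "psd n T" "C = mat_adjoint T * T" using psd_square[OF C] .
  note Sc = psdD(1)[OF S(1)] and Tc = psdD(1)[OF T(1)]
  have DBD: "D * B * D = mat_adjoint (S * D) * (S * D)"
    unfolding S(2) using Sc D hD by (simp add: as mat_adjoint_mult[of _ n n _ n])
  have DCD: "D * C * D = mat_adjoint (T * D) * (T * D)"
    unfolding T(2) using Tc D hD by (simp add: as mat_adjoint_mult[of _ n n _ n])
  have 0: "B * D + D * C = 0\<^sub>m n n"
    unfolding D_def using cs BC
    by (simp add: mult_minus_distrib_mat[of _ n n _ n] minus_mult_distrib_mat[of _ n n _ _ n], intro eq_matI) auto
  have "D * (B * D + D * C) = D * B * D + D * D * C"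
    using cs by (simp add: as mult_add_distrib_mat[of _ n n _ n])
  then have "D * B * D + D * D * C = 0\<^sub>m n n" using D by (simp add: 0)
  then have "tr (D * B * D + D * D * C) = 0" by (simp add: tr_def)
  then have "tr (D * B * D) + tr (D * D * C) = 0"
    using cs by (subst tr_add[symmetric, of _ n]) (auto simp: mult_carrier_mat[of _ n n _ n])
  moreover have "tr (D * D * C) = tr (D * C * D)"
    using tr_comm[of D n n "D * C"] cs by (simp add: as)
  ultimately have "tr (D * B * D) + tr (D * C * D) = 0" by simp
  then have "(\<Sum>i<n. \<Sum>j<n. (cmod ((S * D) $$ (j, i)))\<^sup>2) + (\<Sum>i<n. \<Sum>j<n. (cmod ((T * D) $$ (j, i)))\<^sup>2) = 0"
    unfolding DBD DCD using Sc Tc D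
    by (subst (asm) (1 2) tr_adjoint_mult_self[of _ n n]) (auto simp del: of_real_sum simp flip: of_real_add)
  then have "(\<Sum>i<n. \<Sum>j<n. (cmod ((S * D) $$ (j, i)))\<^sup>2) = 0" "(\<Sum>i<n. \<Sum>j<n. (cmod ((T * D) $$ (j, i)))\<^sup>2) = 0"
    by (subst (asm) add_nonneg_eq_0_iff; simp add: sum_nonneg)+
  then have "S * D = 0\<^sub>m n n" "T * D = 0\<^sub>m n n"
    using Sc Tc D by (auto intro!: adjoint_mult_self_tr_eq_0[of _ n n] simp: tr_adjoint_mult_self[of _ n n] simp del: of_real_sum)
  then have "D * B * D = 0\<^sub>m n n" "D * C * D = 0\<^sub>m n n"
    unfolding DBD DCD using Sc Tc D by auto
  moreover have "D * D * D = D * B * D - D * C * D"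
    using cs unfolding D_def[symmetric] by (subst (2) D_def)
      (simp add: mult_minus_distrib_mat[of _ n n _ n] minus_mult_distrib_mat[of _ n n _ _ n])
  ultimately have D3: "D * D * D = 0\<^sub>m n n" by auto
  \<comment> \<open>\<open>D\<close> is Hermitian, so the vanishing fourth power forces
    \<open>D * D = 0\<close> through the trace, and the vanishing square forces \<open>D = 0\<close>
    in the same way.\<close>
  have "mat_adjoint (D * D) * (D * D) = D * D * D * D"
    using D hD by (simp add: mat_adjoint_mult[of _ n n _ n] as)
  then have "tr (mat_adjoint (D * D) * (D * D)) = 0"
    using D by (simp add: D3) (simp add: tr_def)
  then have "D * D = 0\<^sub>m n n"
    using D by (intro adjoint_mult_self_tr_eq_0) auto
  then have "tr (mat_adjoint D * D) = 0" using hD by (simp add: tr_def)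
  then have "D = 0\<^sub>m n n" using D by (intro adjoint_mult_self_tr_eq_0) auto
  then have "B $$ (i, j) = C $$ (i, j)" if "i < n" "j < n" for i j
  proof -
    have "D $$ (i, j) = 0" using \<open>D = 0\<^sub>m n n\<close> that by simp
    then show ?thesis using that Bc(1) Cc(1) by (simp add: D_def)
  qed
  then show ?thesis using Bc Cc by (intro eq_matI) auto
qed

text \<open>Existence and uniqueness of the positive square root make the definite description
  behind \<open>abs_mat\<close> denote.\<close>

lemma abs_mat:
  assumes A: "A \<in> carrier_mat n m"
  shows "psd m (abs_mat A)" "abs_mat A * abs_mat A = mat_adjoint A * A"
proof -
  obtain B where "psd m B" "B * B = mat_adjoint A * A"
    using psd_sqrt_exists[OF psd_adjoint_mult_self[OF A]] .
  then have "\<exists>!B. psd (dim_col A) B \<and> B * B = mat_adjoint A * A"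
    using A psd_sqrt_unique by auto
  from theI'[OF this] show "psd m (abs_mat A)" "abs_mat A * abs_mat A = mat_adjoint A * A"
    using A unfolding abs_mat_def by auto
qed

text \<open>With \<open>B\<close> the Gram matrix of the columns of \<open>S\<close>, the diagonal
  entries are squared lengths and the second claim is the Cauchy-Schwarz inequality.\<close>

lemma psd_entry_bound:
  assumes "psd n B" "i < n" "j < n"
  shows "0 \<le> Re (B $$ (i, i))" "(cmod (B $$ (i, j)))\<^sup>2 \<le> Re (B $$ (i, i)) * Re (B $$ (j, j))"
proof -
  obtain S where S: "psd n S" "B = mat_adjoint S * S" using psd_square[OF assms(1)] .
  note Sc = psdD(1)[OF S(1)]
  have Be: "B $$ (a, b) = (\<Sum>k<n. cnj (S $$ (k, a)) * S $$ (k, b))" if "a < n" "b < n" for a b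
    unfolding S(2) using mat_adjoint_mult_index[OF Sc Sc that] by simp
  have Bd: "Re (B $$ (a, a)) = (\<Sum>k<n. (cmod (S $$ (k, a)))\<^sup>2)" if "a < n" for a
    by (simp add: Be that cmod_power2 flip: power2_eq_square)
  show "0 \<le> Re (B $$ (i, i))" using assms by (simp add: Bd sum_nonneg)
  have "cmod (B $$ (i, j)) \<le> (\<Sum>k<n. cmod (S $$ (k, i)) * cmod (S $$ (k, j)))"
    unfolding Be[OF assms(2,3)] by (rule order.trans[OF norm_sum]) (simp add: norm_mult)
  then have "(cmod (B $$ (i, j)))\<^sup>2 \<le> (\<Sum>k<n. cmod (S $$ (k, i)) * cmod (S $$ (k, j)))\<^sup>2"
    by (simp add: power_mono)
  also have "\<dots> \<le> (\<Sum>k<n. (cmod (S $$ (k, i)))\<^sup>2) * (\<Sum>k<n. (cmod (S $$ (k, j)))\<^sup>2)"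
    by (rule Cauchy_Schwarz_ineq_sum)
  finally show "(cmod (B $$ (i, j)))\<^sup>2 \<le> Re (B $$ (i, i)) * Re (B $$ (j, j))"
    using assms by (simp add: Bd)
qed

lemma norm2_sq:
  assumes "A \<in> carrier_mat n m"
  shows "(norm2 A)\<^sup>2 = (\<Sum>i<m. \<Sum>j<n. (cmod (A $$ (j, i)))\<^sup>2)"
  unfolding norm2_def tr_adjoint_mult_self[OF assms] by (simp add: sum_nonneg del: of_real_sum)

lemma norm2_nonneg: "A \<in> carrier_mat n m \<Longrightarrow> 0 \<le> norm2 A"
  unfolding norm2_def by (simp add: tr_adjoint_mult_self sum_nonneg del: of_real_sum)

text \<open>\<open>A\<close> and its absolute value \<open>B\<close> have the same 2-norm. Summing
  the entry bounds of the positive matrix \<open>B\<close> over all pairs of indices gives the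
  square of its trace.\<close>

lemma norm2_le_norm1:
  assumes A: "A \<in> carrier_mat n m"
  shows "norm2 A \<le> norm1 A"
proof -
  let ?B = "abs_mat A"
  note B = abs_mat[OF A] and Bc = psdD[OF abs_mat(1)[OF A]]
  have t: "norm1 A = (\<Sum>i<m. Re (?B $$ (i, i)))"
    using Bc(1) by (simp add: norm1_def tr_def)
  have "(norm2 A)\<^sup>2 = (norm2 ?B)\<^sup>2"
    unfolding norm2_def Bc(2) B(2) by simp
  also have "\<dots> = (\<Sum>i<m. \<Sum>j<m. (cmod (?B $$ (j, i)))\<^sup>2)"
    by (rule norm2_sq[OF Bc(1)])
  also have "\<dots> \<le> (\<Sum>i<m. \<Sum>j<m. Re (?B $$ (j, j)) * Re (?B $$ (i, i)))"
    by (intro sum_mono psd_entry_bound(2)[OF B(1)]) auto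
  also have "\<dots> = (norm1 A)\<^sup>2"
    unfolding t power2_eq_square sum_product by (subst sum.swap) simp
  finally show ?thesis
    by (rule power2_le_imp_le) (use psd_entry_bound(1)[OF B(1)] in \<open>fastforce simp: t intro: sum_nonneg\<close>)
qed

section \<open>Orthogonality of the generators\<close>

lemma tr_mult_entries:
  "A \<in> carrier_mat n m \<Longrightarrow> B \<in> carrier_mat m n \<Longrightarrow>
    tr (A * B) = (\<Sum>i<n. \<Sum>j<m. A $$ (i, j) * B $$ (j, i))"
  by (auto simp: tr_def scalar_prod_def atLeast0LessThan intro!: sum.cong)

lemma tr_smult: "A \<in> carrier_mat n n \<Longrightarrow> tr (c \<cdot>\<^sub>m A) = c * (tr A :: 'a :: semiring_0)"
  by (simp add: tr_def sum_distrib_left)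

lemma tr_diff:
  fixes A :: "'a :: ab_group_add mat"
  shows "A \<in> carrier_mat n n \<Longrightarrow> B \<in> carrier_mat n n \<Longrightarrow> tr (A - B) = tr A - tr B"
  by (auto simp: tr_def sum_subtractf)

text \<open>The three kinds of generators with \<open>p < q < d\<close> counted from 0; in each case
  \<open>q = k - 1\<close> is the integer square root of the index of the generator.\<close>

definition sym_gen :: "nat \<Rightarrow> nat \<Rightarrow> nat \<Rightarrow> complex mat" where
  "sym_gen d p q = mat d d (\<lambda>(a, b). if a = p \<and> b = q then 1 else if a = q \<and> b = p then 1 else 0)"

definition antisym_gen :: "nat \<Rightarrow> nat \<Rightarrow> nat \<Rightarrow> complex mat" where
  "antisym_gen d p q = mat d d (\<lambda>(a, b). if a = p \<and> b = q then - \<i> else if a = q \<and> b = p then \<i> else 0)"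

text \<open>The normalising factor of the diagonal generator with \<open>k = q + 1\<close>.\<close>

definition diag_coeff :: "nat \<Rightarrow> real" where
  "diag_coeff q = sqrt (2 / ((real q + 1) * real q))"

definition diag_gen :: "nat \<Rightarrow> nat \<Rightarrow> complex mat" where
  "diag_gen d q = mat d d (\<lambda>(a, b). if a \<noteq> b then 0 else
     diag_coeff q * (if a < q then 1 else if a = q then - of_nat q else 0))"

lemma gen_carrier [simp]:
  "sym_gen d p q \<in> carrier_mat d d" "antisym_gen d p q \<in> carrier_mat d d" "diag_gen d q \<in> carrier_mat d d"
  by (auto simp: sym_gen_def antisym_gen_def diag_gen_def)

text \<open>Let \<open>s\<close> be the integer square root of \<open>m\<close> and \<open>r\<close>
  the offset, so that \<open>r \<le> 2 * s\<close>. The maximal offset \<open>2 * s\<close> gives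
  the diagonal generator, the smaller even and odd ones the other two kinds. The equation for
  \<open>floor_sqrt m\<close> is recorded because it shows that equal indices have equal
  \<open>q\<close>.\<close>

lemma generator_cases:
  assumes "m \<in> {1..d\<^sup>2 - 1}"
  obtains (sym) p q where "p < q" "q < d" "m = q\<^sup>2 + 2 * p" "floor_sqrt m = q" "generator d m = sym_gen d p q"
  | (antisym) p q where "p < q" "q < d" "m = q\<^sup>2 + 2 * p + 1" "floor_sqrt m = q" "generator d m = antisym_gen d p q"
  | (diag) q where "0 < q" "q < d" "m = q\<^sup>2 + 2 * q" "floor_sqrt m = q" "generator d m = diag_gen d q"
proof -
  define s where "s = floor_sqrt m"
  define r where "r = m - s\<^sup>2"
  have s: "s\<^sup>2 \<le> m" "m < (Suc s)\<^sup>2"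
    unfolding s_def by (simp_all add: floor_sqrt_power2_le Suc_floor_sqrt_power2_gt)
  have m: "m = s\<^sup>2 + r" "r \<le> 2 * s" unfolding r_def using s by (auto simp: power2_eq_square)
  have "d > 0" using assms by (cases d) auto
  then have "m < d\<^sup>2" using assms by auto
  then have "s\<^sup>2 < d\<^sup>2" using s(1) by simp
  then have sd: "s < d" using power_less_imp_less_base by blast
  have "s > 0" using assms m by (cases s) auto
  consider "r = 2 * s" | i where "r = 2 * i" "i < s" | i where "r = 2 * i + 1" "i < s"
    using m(2) by (cases "even r") (auto elim!: evenE oddE simp: le_less)
  then show ?thesis
  proof cases
    case 1
    have e: "(s + 1)\<^sup>2 - 1 = m" using m 1 by (simp add: power2_eq_square)
    have g: "generator d m = diag_gen d s"
      using \<open>s > 0\<close> generator_diag[of "s + 1" d, unfolded e]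
      by (intro eq_matI) (auto simp: diag_gen_def diag_coeff_def)
    show ?thesis by (rule diag[OF \<open>s > 0\<close> sd _ s_def[symmetric] g]) (use m 1 in simp)
  next
    case 2
    have g: "generator d m = sym_gen d i s"
      using 2 m generator_sym[of "i + 1" "s + 1" d]
      by (intro eq_matI) (auto simp: sym_gen_def matrix_unit_def)
    show ?thesis by (rule sym[OF 2(2) sd _ s_def[symmetric] g]) (use m 2 in simp)
  next
    case 3
    have g: "generator d m = antisym_gen d i s"
      using 3 m generator_antisym[of "i + 1" "s + 1" d]
      by (intro eq_matI) (auto simp: antisym_gen_def matrix_unit_def)
    show ?thesis by (rule antisym[OF 3(2) sd _ s_def[symmetric] g]) (use m 3 in simp)
  qed
qed

lemma generator_carrier [simp]: "generator d m \<in> carrier_mat d d"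
  unfolding generator_def matrix_unit_def Let_def by auto

lemma generator_adjoint:
  assumes "m \<in> {1..d\<^sup>2 - 1}" shows "mat_adjoint (generator d m) = generator d m"
proof -
  have "mat_adjoint (sym_gen d p q) = sym_gen d p q" if "p < q" for p q
    by (rule eq_matI) (use that in \<open>auto simp: sym_gen_def\<close>)
  note s = this
  have a: "mat_adjoint (antisym_gen d p q) = antisym_gen d p q" if "p < q" for p q
    by (rule eq_matI) (use that in \<open>auto simp: antisym_gen_def\<close>)
  have g: "mat_adjoint (diag_gen d q) = diag_gen d q" for q
    by (rule eq_matI) (auto simp: diag_gen_def)
  from assms show ?thesis by (cases rule: generator_cases) (auto simp: s a g)
qed

text \<open>This and the next two formulas reduce the trace against a generator to a few entries of
  the other factor, so that orthogonality becomes a matter of reading off entries.\<close>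

lemma tr_sym_gen_mult:
  assumes B: "B \<in> carrier_mat d d" and pq: "p < q" "q < d"
  shows "tr (sym_gen d p q * B) = B $$ (q, p) + B $$ (p, q)"
proof -
  have "tr (sym_gen d p q * B) = (\<Sum>a<d. \<Sum>b<d. (if b = q then (if a = p then B $$ (q, p) else 0) else 0)
      + (if b = p then (if a = q then B $$ (p, q) else 0) else 0))"
    unfolding tr_mult_entries[OF gen_carrier(1) B]
    using pq by (intro sum.cong refl) (auto simp: sym_gen_def)
  then show ?thesis using pq by (simp add: sum.distrib)
qed

lemma tr_antisym_gen_mult:
  assumes B: "B \<in> carrier_mat d d" and pq: "p < q" "q < d"
  shows "tr (antisym_gen d p q * B) = - \<i> * B $$ (q, p) + \<i> * B $$ (p, q)"
proof -
  have "tr (antisym_gen d p q * B) = (\<Sum>a<d. \<Sum>b<d. (if b = q then (if a = p then - \<i> * B $$ (q, p) else 0) else 0)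
      + (if b = p then (if a = q then \<i> * B $$ (p, q) else 0) else 0))"
    unfolding tr_mult_entries[OF gen_carrier(2) B]
    using pq by (intro sum.cong refl) (auto simp: antisym_gen_def)
  then show ?thesis using pq by (simp add: sum.distrib)
qed

lemma tr_diag_gen_mult:
  assumes B: "B \<in> carrier_mat d d" and q: "q < d"
  shows "tr (diag_gen d q * B) = diag_coeff q * ((\<Sum>a<q. B $$ (a, a)) - of_nat q * B $$ (q, q))"
proof -
  have "tr (diag_gen d q * B) = (\<Sum>a<d. \<Sum>b<d. if b = a then
      diag_coeff q * (if a < q then 1 else if a = q then - of_nat q else 0) * B $$ (a, a) else 0)"
    unfolding tr_mult_entries[OF gen_carrier(3) B]
    by (intro sum.cong refl) (auto simp: diag_gen_def)
  also have "\<dots> = (\<Sum>a<d. diag_coeff q * ((if a < q then B $$ (a, a) else 0) - (if a = q then of_nat q * B $$ (a, a) else 0)))"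
    by (intro sum.cong refl) auto
  also have "\<dots> = diag_coeff q * ((\<Sum>a<d. if a < q then B $$ (a, a) else 0) - (\<Sum>a<d. if a = q then of_nat q * B $$ (a, a) else 0))"
    by (simp only: sum_distrib_left[symmetric] sum_subtractf)
  also have "(\<Sum>a<d. if a < q then B $$ (a, a) else 0) = (\<Sum>a<q. B $$ (a, a))"
    using q by (intro sum.mono_neutral_cong_right) auto
  finally show ?thesis using q by simp
qed

lemma tr_generator:
  assumes "m \<in> {1..d\<^sup>2 - 1}" shows "tr (generator d m) = 0"
proof -
  \<comment> \<open>Inserting the identity makes the formulas for traces of products
    applicable.\<close>
  have 1: "tr A = tr (A * 1\<^sub>m d)" if "A \<in> carrier_mat d d" for A :: "complex mat"
    using that by simp
  from assms show ?thesis
  proof (cases rule: generator_cases)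
    case (sym p q)
    show ?thesis unfolding sym(5) using sym(1,2) by (subst 1) (simp_all add: tr_sym_gen_mult del: right_mult_one_mat)
  next
    case (antisym p q)
    show ?thesis unfolding antisym(5) using antisym(1,2) by (subst 1) (simp_all add: tr_antisym_gen_mult del: right_mult_one_mat)
  next
    case (diag q)
    show ?thesis unfolding diag(5) using diag(1,2) by (subst 1) (simp_all add: tr_diag_gen_mult del: right_mult_one_mat)
  qed
qed

text \<open>For \<open>q < r\<close> the first \<open>q + 1\<close> diagonal entries of
  \<open>diag_gen d r\<close> are equal, so the sum of the first \<open>q\<close> of them cancels
  against \<open>q\<close> times the next. For \<open>q = r\<close> the value is
  \<open>q * (q + 1)\<close> times the squared normalising factor, that is 2.\<close>

lemma tr_diag_diag:
  assumes "0 < q" "q \<le> r" "r < d"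
  shows "tr (diag_gen d q * diag_gen d r) = (if q = r then 2 else 0)"
proof -
  have "(diag_coeff q)\<^sup>2 * ((real q + 1) * real q) = 2"
    using assms by (simp add: diag_coeff_def)
  from arg_cong[OF this, of complex_of_real]
  have c: "complex_of_real (diag_coeff q) * diag_coeff q * ((of_nat q + 1) * of_nat q) = 2"
    by (simp add: power2_eq_square)
  have s: "(\<Sum>a<q. diag_gen d r $$ (a, a)) = of_nat q * diag_coeff r"
    using assms by (simp add: diag_gen_def)
  show ?thesis
    using assms c by (subst tr_diag_gen_mult) (auto simp: s diag_gen_def algebra_simps)
qed

lemma tr_mixed_gen:
  assumes "p < q" "q < d" "i < r" "r < d"
  shows "tr (sym_gen d p q * antisym_gen d i r) = 0"
    and "0 < s \<Longrightarrow> s < d \<Longrightarrow> tr (sym_gen d p q * diag_gen d s) = 0"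
    and "0 < s \<Longrightarrow> s < d \<Longrightarrow> tr (antisym_gen d p q * diag_gen d s) = 0"
    and "tr (sym_gen d p q * sym_gen d i r) = (if p = i \<and> q = r then 2 else 0)"
    and "tr (antisym_gen d p q * antisym_gen d i r) = (if p = i \<and> q = r then 2 else 0)"
  using assms
  by (auto simp: tr_sym_gen_mult tr_antisym_gen_mult, auto simp: sym_gen_def antisym_gen_def diag_gen_def)

text \<open>Equal indices have the same integer square root \<open>q\<close>, hence the same offset.
  The offsets \<open>2 * p\<close>, \<open>2 * p + 1\<close> and \<open>2 * q\<close> with
  \<open>p < q\<close> tell the three kinds apart by parity and size; so in each case
  \<open>m = l\<close> is decided by the parameters.\<close>

lemma tr_generator_mult:
  assumes m: "m \<in> {1..d\<^sup>2 - 1}" and l: "l \<in> {1..d\<^sup>2 - 1}"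
  shows "tr (generator d m * generator d l) = (if m = l then 2 else 0)"
proof -
  note comm = tr_comm[OF generator_carrier[of d m] generator_carrier[of d l]]
  have par: "2 * a \<noteq> 2 * b + 1" for a b :: nat by presburger
  from m show ?thesis
  proof (cases rule: generator_cases)
    case s: (sym p q)
    from l show ?thesis
    proof (cases rule: generator_cases)
      case t: (sym i h)
      have "m = l \<Longrightarrow> q = h" using s(4) t(4) by blast
      then have "m = l \<longleftrightarrow> p = i \<and> q = h" using s(3) t(3) by auto
      then show ?thesis using tr_mixed_gen(4)[OF s(1,2) t(1,2)] unfolding s(5) t(5) by simp
    next
      case t: (antisym i h)
      have "m = l \<Longrightarrow> q = h" using s(4) t(4) by blast
      then have "m \<noteq> l" using s(3) t(3) par[of p i] by auto
      then show ?thesis using tr_mixed_gen(1)[OF s(1,2) t(1,2)] unfolding s(5) t(5) by simp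
    next
      case t: (diag h)
      have "m = l \<Longrightarrow> q = h" using s(4) t(4) by blast
      then have "m \<noteq> l" using s(1,3) t(3) by auto
      then show ?thesis using tr_mixed_gen(2)[OF s(1,2) s(1,2) t(1,2)] unfolding s(5) t(5) by simp
    qed
  next
    case s: (antisym p q)
    from l show ?thesis
    proof (cases rule: generator_cases)
      case t: (sym i h)
      have "m = l \<Longrightarrow> q = h" using s(4) t(4) by blast
      then have "m \<noteq> l" using s(3) t(3) par[of i p] by auto
      then show ?thesis using tr_mixed_gen(1)[OF t(1,2) s(1,2)] comm unfolding s(5) t(5) by simp
    next
      case t: (antisym i h)
      have "m = l \<Longrightarrow> q = h" using s(4) t(4) by blast
      then have "m = l \<longleftrightarrow> p = i \<and> q = h" using s(3) t(3) by auto
      then show ?thesis using tr_mixed_gen(5)[OF s(1,2) t(1,2)] unfolding s(5) t(5) by simp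
    next
      case t: (diag h)
      have "m = l \<Longrightarrow> q = h" using s(4) t(4) by blast
      then have "m \<noteq> l" using s(3) t(3) par[of h p] by auto
      then show ?thesis using tr_mixed_gen(3)[OF s(1,2) s(1,2) t(1,2)] unfolding s(5) t(5) by simp
    qed
  next
    case s: (diag q)
    from l show ?thesis
    proof (cases rule: generator_cases)
      case t: (sym i h)
      have "m = l \<Longrightarrow> q = h" using s(4) t(4) by blast
      then have "m \<noteq> l" using s(3) t(1,3) by auto
      then show ?thesis using tr_mixed_gen(2)[OF t(1,2) t(1,2) s(1,2)] comm unfolding s(5) t(5) by simp
    next
      case t: (antisym i h)
      have "m = l \<Longrightarrow> q = h" using s(4) t(4) by blast
      then have "m \<noteq> l" using s(3) t(3) par[of q i] by auto
      then show ?thesis using tr_mixed_gen(3)[OF t(1,2) t(1,2) s(1,2)] comm unfolding s(5) t(5) by simp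
    next
      case t: (diag h)
      have "m = l \<Longrightarrow> q = h" using s(4) t(4) by blast
      then have "m = l \<longleftrightarrow> q = h" using s(3) t(3) by auto
      then show ?thesis
        using tr_diag_diag[of q h d] tr_diag_diag[of h q d] s(1,2) t(1,2) comm unfolding s(5) t(5)
        by (cases "q \<le> h") auto
    qed
  qed
qed

section \<open>Rank-one projective measurements\<close>

text \<open>A maximal independent set of columns has as many elements as the rank, so it is a single
  \<open>v\<close>. By maximality every other column depends on \<open>v\<close>, hence is a
  multiple of it.\<close>

lemma (in vec_space) rank_1_product_entries:
  assumes A: "A \<in> carrier_mat n nc" and rank: "rank A = 1"
  obtains f g where "\<And>i j. i < n \<Longrightarrow> j < nc \<Longrightarrow> A $$ (i, j) = f i * g j"
proof -
  obtain S where S: "maximal S (\<lambda>T. T \<subseteq> set (cols A) \<and> lin_indpt T)"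
    using maximal_exists_superset[of "set (cols A)" "\<lambda>T. T \<subseteq> set (cols A) \<and> lin_indpt T" "{}"]
    by (auto simp: lin_dep_def)
  then have "card S = 1" using rank_card_indpt[OF A] rank by simp
  then obtain v where v: "S = {v}" by (auto simp: card_Suc_eq)
  have cA: "set (cols A) \<subseteq> carrier_vec n" using cols_dim[of A] A by auto
  have Sprop: "{v} \<subseteq> set (cols A)" "lin_indpt {v}"
    using S unfolding maximal_def v by auto
  then have vc: "v \<in> carrier_vec n" using cA by auto
  have ex: "\<exists>c. col A j = c \<cdot>\<^sub>v v" if "j < nc" for j
  proof -
    have w: "col A j \<in> set (cols A)" using that A by (auto simp: cols_def)
    then have wc: "col A j \<in> carrier_vec n" using cA by auto
    have "col A j \<in> span {v}"
    proof (cases "col A j = v")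
      case True
      then show ?thesis using in_own_span[of "{v}"] vc by auto
    next
      case False
      have "lin_dep (insert (col A j) {v})"
        using S w Sprop False unfolding maximal_def v by blast
      then show ?thesis
        using lin_dep_iff_in_span[of "{v}" "col A j"] Sprop vc wc False by (auto simp: insert_commute)
    qed
    then obtain a where "col A j = lincomb a {v}"
      using finite_span[of "{v}"] vc by auto
    moreover have "lincomb a {v} = a v \<cdot>\<^sub>v v"
      using vc by (simp add: lincomb_def)
    ultimately show ?thesis by (intro exI[of _ "a v"]) simp
  qed
  then obtain g where g: "\<And>j. j < nc \<Longrightarrow> col A j = g j \<cdot>\<^sub>v v" by metis
  have "A $$ (i, j) = v $ i * g j" if "i < n" "j < nc" for i j
    using arg_cong[OF g[OF that(2)], of "\<lambda>w. w $ i"] that A vc by simp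
  then show ?thesis using that by blast
qed

text \<open>Each product term has rank at most one, and the rank is subadditive.\<close>

lemma (in vec_space) rank_le_sum_product_entries:
  assumes "A \<in> carrier_mat n nc"
    and "\<And>r c. r < n \<Longrightarrow> c < nc \<Longrightarrow> A $$ (r, c) = (\<Sum>l<m. f l r * g l c)"
  shows "rank A \<le> m"
  using assms
proof (induction m arbitrary: A)
  case 0
  then have "A = 0\<^sub>m n nc" by (intro eq_matI) auto
  then show ?case using rank_0I by simp
next
  case (Suc m)
  define B where "B = mat n nc (\<lambda>(r, c). \<Sum>l<m. f l r * g l c)"
  define C where "C = mat n nc (\<lambda>(r, c). f m r * g m c)"
  have B: "B \<in> carrier_mat n nc" and C: "C \<in> carrier_mat n nc" by (auto simp: B_def C_def)
  have "A = B + C" using Suc.prems by (intro eq_matI) (auto simp: B_def C_def)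
  then have "rank A \<le> rank B + rank C" using rank_subadditive[OF B C] by simp
  moreover have "rank B \<le> m" by (rule Suc.IH[OF B]) (simp add: B_def)
  moreover have "rank C \<le> 1" by (rule rank_le_1_product_entries[OF C]) (simp add: C_def)
  ultimately show ?case by simp
qed

text \<open>For entries \<open>f i * g j\<close> the product of the entries at \<open>(i, a)\<close>
  and \<open>(b, j)\<close> equals that of the entries at \<open>(b, a)\<close> and
  \<open>(i, j)\<close>, which pulls the trace out of \<open>P * X * P\<close>. With the identity
  for \<open>X\<close> this reads \<open>P = tr P \<cdot>\<^sub>m P\<close>, and \<open>P\<close> is
  not zero.\<close>

lemma rank_one_projector:
  assumes P: "orthogonal_projector d P" and rank: "vec_space.rank d P = 1"
  shows "tr P = 1" and "X \<in> carrier_mat d d \<Longrightarrow> P * X * P = tr (P * X) \<cdot>\<^sub>m P"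
proof -
  interpret vec_space "TYPE(complex)" d .
  have Pc: "P \<in> carrier_mat d d" and PP: "P * P = P" using P by (auto simp: orthogonal_projector_def)
  obtain f g where fg: "\<And>i j. i < d \<Longrightarrow> j < d \<Longrightarrow> P $$ (i, j) = f i * g j"
    using rank_1_product_entries[OF Pc rank] by blast
  show sandwich: "P * X * P = tr (P * X) \<cdot>\<^sub>m P" if X: "X \<in> carrier_mat d d" for X
  proof (rule eq_matI)
    fix i j assume "i < dim_row (tr (P * X) \<cdot>\<^sub>m P)" "j < dim_col (tr (P * X) \<cdot>\<^sub>m P)"
    then have ij: "i < d" "j < d" using Pc by auto
    have "(P * X * P) $$ (i, j) = (\<Sum>a<d. \<Sum>b<d. P $$ (i, a) * (X $$ (a, b) * P $$ (b, j)))"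
      using Pc X ij by (auto simp: scalar_prod_def atLeast0LessThan sum_distrib_left intro!: sum.cong)
    also have "\<dots> = (\<Sum>b<d. \<Sum>a<d. P $$ (b, a) * X $$ (a, b)) * P $$ (i, j)"
      using ij by (subst sum.swap) (auto simp: fg sum_distrib_right intro!: sum.cong)
    finally show "(P * X * P) $$ (i, j) = (tr (P * X) \<cdot>\<^sub>m P) $$ (i, j)"
      using ij Pc by (simp add: tr_mult_entries[OF Pc X])
  qed (use Pc X in auto)
  have "P \<noteq> 0\<^sub>m d d" using rank rank_0I[of d] by auto
  then obtain i j where ij: "i < d" "j < d" "P $$ (i, j) \<noteq> 0"
    using Pc by (metis carrier_matD eq_matI index_zero_mat)
  have "P = tr P \<cdot>\<^sub>m P" using sandwich[of "1\<^sub>m d"] Pc PP by simp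
  from arg_cong[OF this, of "\<lambda>M. M $$ (i, j)"] show "tr P = 1" using ij Pc by simp
qed

section \<open>Bessel's inequality for Hermitian matrices\<close>

lemma tr_hermitian_mult_real:
  fixes A B :: "complex mat"
  assumes "A \<in> carrier_mat n n" "B \<in> carrier_mat n n" "mat_adjoint A = A" "mat_adjoint B = B"
  shows "tr (A * B) \<in> \<real>"
proof -
  have h: "cnj (A $$ (i, j)) = A $$ (j, i)" "cnj (B $$ (i, j)) = B $$ (j, i)" if "i < n" "j < n" for i j
    using arg_cong[OF assms(3), of "\<lambda>M. M $$ (j, i)"] arg_cong[OF assms(4), of "\<lambda>M. M $$ (j, i)"] assms(1,2) that by auto
  have "cnj (tr (A * B)) = tr (A * B)"
    unfolding tr_mult_entries[OF assms(1,2)]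
    by (simp add: h, subst sum.swap, simp)
  then show ?thesis by (simp add: Reals_cnj_iff)
qed

text \<open>Expand \<open>0 \<le> \<parallel>g - (\<Sum>i. p\<^sub>i / c\<^sub>i f\<^sub>i)\<parallel>\<^sup>2\<close>, where \<open>p\<^sub>i\<close> is the inner product of \<open>f\<^sub>i\<close> and \<open>g\<close>.\<close>

lemma bessel_sum:
  fixes f :: "'i \<Rightarrow> 's \<Rightarrow> complex"
  assumes I: "finite I" and S: "finite S"
    and orth: "\<And>i j. i \<in> I \<Longrightarrow> j \<in> I \<Longrightarrow> (\<Sum>s\<in>S. cnj (f i s) * f j s) = (if i = j then of_real (c i) else 0)"
    and c: "\<And>i. i \<in> I \<Longrightarrow> 0 < c i"
  shows "(\<Sum>i\<in>I. (cmod (\<Sum>s\<in>S. cnj (f i s) * g s))\<^sup>2 / c i) \<le> (\<Sum>s\<in>S. (cmod (g s))\<^sup>2)"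
proof -
  define p where "p i = (\<Sum>s\<in>S. cnj (f i s) * g s)" for i
  \<comment> \<open>\<open>h\<close> is the orthogonal projection of \<open>g\<close> onto the span
    of the \<open>f i\<close>; therefore its inner products with \<open>g\<close> and with itself
    coincide.\<close>
  define h where "h s = (\<Sum>i\<in>I. p i / c i * f i s)" for s
  have n2: "complex_of_real ((cmod z)\<^sup>2) = z * cnj z" for z by (rule complex_norm_square)
  have cp: "cnj (p i) = (\<Sum>s\<in>S. cnj (g s) * f i s)" for i
    by (simp add: p_def mult.commute)
  have gh: "(\<Sum>s\<in>S. cnj (g s) * h s) = (\<Sum>i\<in>I. p i * cnj (p i) / c i)"
  proof -
    have "(\<Sum>s\<in>S. cnj (g s) * h s) = (\<Sum>i\<in>I. \<Sum>s\<in>S. p i / c i * (cnj (g s) * f i s))"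
      unfolding h_def sum_distrib_left by (subst sum.swap) (simp add: ac_simps)
    also have "\<dots> = (\<Sum>i\<in>I. p i * cnj (p i) / c i)"
      by (intro sum.cong refl) (simp add: cp sum_distrib_left sum_divide_distrib)
    finally show ?thesis .
  qed
  have hh: "(\<Sum>s\<in>S. cnj (h s) * h s) = (\<Sum>i\<in>I. p i * cnj (p i) / c i)"
  proof -
    have "(\<Sum>s\<in>S. cnj (h s) * h s) = (\<Sum>s\<in>S. \<Sum>i\<in>I. \<Sum>j\<in>I. cnj (p i) / c i * (p j / c j) * (cnj (f i s) * f j s))"
      unfolding h_def cnj_sum sum_product by (simp add: ac_simps)
    also have "\<dots> = (\<Sum>i\<in>I. \<Sum>j\<in>I. \<Sum>s\<in>S. cnj (p i) / c i * (p j / c j) * (cnj (f i s) * f j s))"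
      by (subst sum.swap, rule sum.cong[OF refl], rule sum.swap)
    also have "\<dots> = (\<Sum>i\<in>I. \<Sum>j\<in>I. cnj (p i) / c i * (p j / c j) * (if i = j then of_real (c i) else 0))"
      by (intro sum.cong refl) (subst orth[symmetric], auto simp: sum_distrib_left)
    also have "\<dots> = (\<Sum>i\<in>I. \<Sum>j\<in>I. if i = j then p i * cnj (p i) / c i else 0)"
      using c by (intro sum.cong refl) auto
    finally show ?thesis using I by simp
  qed
  have hg: "(\<Sum>s\<in>S. g s * cnj (h s)) = (\<Sum>i\<in>I. p i * cnj (p i) / c i)"
    using arg_cong[OF gh, of cnj] by (simp add: ac_simps)
  have "complex_of_real (\<Sum>s\<in>S. (cmod (g s - h s))\<^sup>2) =
      (\<Sum>s\<in>S. g s * cnj (g s) - cnj (g s) * h s - g s * cnj (h s) + cnj (h s) * h s)"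
    by (simp add: n2 algebra_simps del: of_real_power)
  also have "\<dots> = (\<Sum>s\<in>S. g s * cnj (g s)) - (\<Sum>i\<in>I. p i * cnj (p i) / c i)"
    by (simp add: sum.distrib sum_subtractf gh hh hg)
  also have "\<dots> = complex_of_real ((\<Sum>s\<in>S. (cmod (g s))\<^sup>2) - (\<Sum>i\<in>I. (cmod (p i))\<^sup>2 / c i))"
    by (simp add: n2 del: of_real_power)
  finally have "(\<Sum>s\<in>S. (cmod (g s - h s))\<^sup>2) = (\<Sum>s\<in>S. (cmod (g s))\<^sup>2) - (\<Sum>i\<in>I. (cmod (p i))\<^sup>2 / c i)"
    by (simp only: of_real_eq_iff)
  moreover have "0 \<le> (\<Sum>s\<in>S. (cmod (g s - h s))\<^sup>2)" by (simp add: sum_nonneg)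
  ultimately show ?thesis by (simp add: p_def)
qed

text \<open>Reads the trace of a product as the inner product of two functions on index pairs, so
  that \<open>bessel_sum\<close> applies to matrices.\<close>

lemma tr_hermitian_mult_sum:
  assumes "A \<in> carrier_mat n n" "mat_adjoint A = A" "B \<in> carrier_mat n n"
  shows "tr (A * B) = (\<Sum>s\<in>{..<n} \<times> {..<n}. cnj (A $$ s) * B $$ s)"
proof -
  have h: "cnj (A $$ (j, i)) = A $$ (i, j)" if "i < n" "j < n" for i j
    using arg_cong[OF assms(2), of "\<lambda>M. M $$ (i, j)"] assms(1) that by simp
  show ?thesis
    unfolding tr_mult_entries[OF assms(1,3)] sum.cartesian_product'
    by (subst sum.swap) (auto simp: h intro!: sum.cong)
qed

lemma bessel_hermitian:
  assumes I: "finite I" and F: "\<And>i. i \<in> I \<Longrightarrow> F i \<in> carrier_mat n n" "\<And>i. i \<in> I \<Longrightarrow> mat_adjoint (F i) = F i"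
    and orth: "\<And>i j. i \<in> I \<Longrightarrow> j \<in> I \<Longrightarrow> tr (F i * F j) = (if i = j then of_real (c i) else 0)"
    and c: "\<And>i. i \<in> I \<Longrightarrow> 0 < c i" and X: "X \<in> carrier_mat n n"
  shows "(\<Sum>i\<in>I. (cmod (tr (F i * X)))\<^sup>2 / c i) \<le> (norm2 X)\<^sup>2"
proof -
  have "(\<Sum>i\<in>I. (cmod (\<Sum>s\<in>{..<n} \<times> {..<n}. cnj (F i $$ s) * X $$ s))\<^sup>2 / c i)
      \<le> (\<Sum>s\<in>{..<n} \<times> {..<n}. (cmod (X $$ s))\<^sup>2)"
    by (rule bessel_sum[OF I _ _ c]) (auto simp: orth F simp flip: tr_hermitian_mult_sum[of _ n])
  also have "\<dots> = (norm2 X)\<^sup>2"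
    unfolding norm2_sq[OF X] sum.cartesian_product' by (rule sum.swap)
  also have "(\<Sum>i\<in>I. (cmod (\<Sum>s\<in>{..<n} \<times> {..<n}. cnj (F i $$ s) * X $$ s))\<^sup>2 / c i)
      = (\<Sum>i\<in>I. (cmod (tr (F i * X)))\<^sup>2 / c i)"
    using F X by (intro sum.cong refl) (simp add: tr_hermitian_mult_sum[of _ n])
  finally show ?thesis .
qed

section \<open>The measurement map on one subsystem\<close>

lemma sum_square_mats_index [simp]:
  "a < n \<Longrightarrow> b < n \<Longrightarrow> sum_square_mats n I F $$ (a, b) = (\<Sum>i\<in>I. F i $$ (a, b))"
  unfolding sum_square_mats_def by simp

lemma sum_square_mats_carrier [simp]: "sum_square_mats n I F \<in> carrier_mat n n"
  unfolding sum_square_mats_def by simp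

lemma tr_mult_sum_square_mats:
  fixes A :: "complex mat"
  assumes "A \<in> carrier_mat n n" "\<And>i. i \<in> I \<Longrightarrow> F i \<in> carrier_mat n n"
  shows "tr (A * sum_square_mats n I F) = (\<Sum>i\<in>I. tr (A * F i))"
proof -
  have "tr (A * sum_square_mats n I F) = (\<Sum>a<n. \<Sum>b<n. \<Sum>i\<in>I. A $$ (a, b) * F i $$ (b, a))"
    using assms(1) by (simp add: tr_mult_entries[of _ n n] sum_distrib_left)
  also have "\<dots> = (\<Sum>a<n. \<Sum>i\<in>I. \<Sum>b<n. A $$ (a, b) * F i $$ (b, a))"
    by (rule sum.cong[OF refl], rule sum.swap)
  also have "\<dots> = (\<Sum>i\<in>I. \<Sum>a<n. \<Sum>b<n. A $$ (a, b) * F i $$ (b, a))"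
    by (rule sum.swap)
  also have "\<dots> = (\<Sum>i\<in>I. tr (A * F i))"
    using assms by (intro sum.cong refl) (simp add: tr_mult_entries[of _ n n])
  finally show ?thesis .
qed

lemma measurement_projector:
  assumes "projective_measurement d P" "k \<in> {1..d}"
  shows "P k \<in> carrier_mat d d" "mat_adjoint (P k) = P k" "P k * P k = P k" "tr (P k) = 1"
    "X \<in> carrier_mat d d \<Longrightarrow> P k * X * P k = tr (P k * X) \<cdot>\<^sub>m P k"
  using assms rank_one_projector[of d "P k"]
  unfolding projective_measurement_def orthogonal_projector_def by auto

lemma tr_measurement_mult:
  assumes "projective_measurement d P" "k \<in> {1..d}" "l \<in> {1..d}"
  shows "tr (P k * P l) = (if k = l then 1 else 0)"
proof (cases "k = l")
  case True
  then show ?thesis using measurement_projector[OF assms(1,2)] by simp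
next
  case False
  then have "P k * P l = 0\<^sub>m d d" using assms unfolding projective_measurement_def by blast
  then show ?thesis using False by (simp add: tr_def)
qed

definition pinching :: "nat \<Rightarrow> (nat \<Rightarrow> complex mat) \<Rightarrow> complex mat \<Rightarrow> complex mat" where
  "pinching d P X = sum_square_mats d {1..d} (\<lambda>k. P k * X * P k)"

lemma pinching_carrier [simp]: "pinching d P X \<in> carrier_mat d d"
  unfolding pinching_def by simp

text \<open>The pinching of \<open>X\<close> is the sum of the
  \<open>tr (P k * X) \<cdot>\<^sub>m P k\<close>, the orthogonal projection of \<open>X\<close>
  onto the span of the orthonormal \<open>P k\<close> for the trace inner product. So
  \<open>tr (X * ?Q)\<close> and \<open>tr (?Q * ?Q)\<close> agree and the claim is
  Pythagoras.\<close>

lemma norm2_diff_pinching: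
  assumes P: "projective_measurement d P" and X: "X \<in> carrier_mat d d" "mat_adjoint X = X"
  shows "(norm2 (X - pinching d P X))\<^sup>2 = (norm2 X)\<^sup>2 - (\<Sum>k\<in>{1..d}. (Re (tr (P k * X)))\<^sup>2)"
proof -
  note Pk = measurement_projector[OF P]
  have r: "tr (P k * X) = of_real (Re (tr (P k * X)))" if "k \<in> {1..d}" for k
    using tr_hermitian_mult_real[OF Pk(1)[OF that] X(1) Pk(2)[OF that] X(2)]
    by (simp add: complex_is_Real_iff complex_eq_iff)
  let ?Q = "pinching d P X"
  have Q: "?Q = sum_square_mats d {1..d} (\<lambda>k. of_real (Re (tr (P k * X))) \<cdot>\<^sub>m P k)"
    unfolding pinching_def using Pk(5)[OF _ X(1)] r
    by (intro eq_matI) (auto simp: sum_square_mats_def intro!: sum.cong)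
  have Ph: "cnj (P k $$ (b, a)) = P k $$ (a, b)" if "k \<in> {1..d}" "a < d" "b < d" for k a b
    using arg_cong[OF Pk(2)[OF that(1)], of "\<lambda>M. M $$ (a, b)"] Pk(1)[OF that(1)] that by simp
  have Pi: "(c \<cdot>\<^sub>m P k) $$ (a, b) = c * P k $$ (a, b)" if "k \<in> {1..d}" "a < d" "b < d" for k a b c
    using Pk(1)[OF that(1)] that by simp
  have hQ: "mat_adjoint ?Q = ?Q"
    unfolding Q by (rule eq_matI) (auto simp: sum_square_mats_def Ph Pi intro!: sum.cong)
  have XQ: "tr (X * ?Q) = of_real (\<Sum>k\<in>{1..d}. (Re (tr (P k * X)))\<^sup>2)"
  proof -
    have "tr (X * (c \<cdot>\<^sub>m P k)) = c * tr (P k * X)" if "k \<in> {1..d}" for k c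
      using Pk(1)[OF that] X by (simp add: mult_smult_distrib[of _ d d _ d] tr_smult[of _ d] tr_comm[of X d d])
    then show ?thesis
      unfolding Q using Pk(1) X r
      by (subst tr_mult_sum_square_mats) (auto simp: power2_eq_square intro!: sum.cong)
  qed
  have QQ: "tr (?Q * ?Q) = of_real (\<Sum>k\<in>{1..d}. (Re (tr (P k * X)))\<^sup>2)"
  proof -
    have "tr (?Q * P k) = tr (P k * X)" if "k \<in> {1..d}" for k
    proof -
      have "tr (?Q * P k) = tr (P k * ?Q)" using Pk(1)[OF that] by (simp add: tr_comm[of _ d d])
      also have "\<dots> = (\<Sum>l\<in>{1..d}. tr (P l * X) * tr (P k * P l))"
        unfolding Q using Pk(1) that
        by (subst tr_mult_sum_square_mats) (auto simp: mult_smult_distrib[of _ d d _ d] tr_smult[of _ d] mult_carrier_mat[of _ d d _ d] r[symmetric] intro!: sum.cong)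
      also have "\<dots> = (\<Sum>l\<in>{1..d}. if l = k then tr (P l * X) else 0)"
        using tr_measurement_mult[OF P that] by (intro sum.cong refl) auto
      finally show ?thesis using that by simp
    qed
    then have "tr (?Q * (c \<cdot>\<^sub>m P k)) = c * tr (P k * X)" if "k \<in> {1..d}" for k c
      using Pk(1)[OF that] that
      by (simp add: mult_smult_distrib[of _ d d _ d] tr_smult[of _ d] mult_carrier_mat[of _ d d _ d])
    then show ?thesis
      by (subst (2) Q) (use Pk(1) r in \<open>subst tr_mult_sum_square_mats, auto simp: power2_eq_square intro!: sum.cong\<close>)
  qed
  have n: "of_real ((norm2 A)\<^sup>2) = tr (A * A)" if "A \<in> carrier_mat d d" "mat_adjoint A = A" for A
    using tr_adjoint_mult_self[OF that(1)] that(2) norm2_sq[OF that(1)] by simp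
  have "mat_adjoint (X - ?Q) = X - ?Q"
  proof (rule eq_matI)
    fix i j assume "i < dim_row (X - ?Q)" "j < dim_col (X - ?Q)"
    then have "i < d" "j < d" by (auto simp: carrier_matD[OF pinching_carrier])
    then show "mat_adjoint (X - ?Q) $$ (i, j) = (X - ?Q) $$ (i, j)"
      using arg_cong[OF hQ, of "\<lambda>M. M $$ (i, j)"] arg_cong[OF X(2), of "\<lambda>M. M $$ (i, j)"] X(1)
        carrier_matD[OF pinching_carrier[of d P X]] by simp
  qed (use X(1) carrier_matD[OF pinching_carrier[of d P X]] in auto)
  then have "of_real ((norm2 (X - ?Q))\<^sup>2) = tr ((X - ?Q) * (X - ?Q))"
    by (intro n minus_carrier_mat) auto
  also have "\<dots> = tr (X * X) - tr (X * ?Q) - (tr (?Q * X) - tr (?Q * ?Q))"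
    using X(1) by (simp add: mult_minus_distrib_mat[of _ d d _ d] minus_mult_distrib_mat[of _ d d _ _ d] tr_diff[of _ d] minus_carrier_mat mult_carrier_mat[of _ d d _ d])
  also have "tr (?Q * X) = tr (X * ?Q)" using X(1) by (intro tr_comm) auto
  also have "tr (X * X) = of_real ((norm2 X)\<^sup>2)" using n[OF X] by simp
  finally have "complex_of_real ((norm2 (X - ?Q))\<^sup>2) = of_real ((norm2 X)\<^sup>2 - (\<Sum>k\<in>{1..d}. (Re (tr (P k * X)))\<^sup>2))"
    by (simp add: XQ QQ)
  then show ?thesis by (simp only: of_real_eq_iff)
qed

section \<open>Eigenvalues of the correlation matrix\<close>

lemma proots_linear_prod: "proots (\<Prod>e\<leftarrow>es. [:- e, 1 :: 'a :: idom:]) = mset es"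
proof (induction es)
  case (Cons e es)
  have "(\<Prod>e\<leftarrow>es. [:- e, 1 :: 'a:]) \<noteq> 0" by (auto simp: prod_list_zero_iff)
  then show ?case using Cons by (simp add: proots_mult del: mult_pCons_left)
qed simp

text \<open>Over the complex numbers the matrix is Hermitian and its eigenvalues are real, so the
  complex factorization is the image of a real one. Injectivity of the embedding of polynomials
  brings it back; hence all \<open>n\<close> roots occur in the list.\<close>

lemma symmetric_char_poly:
  fixes S :: "real mat"
  assumes S: "S \<in> carrier_mat n n" and sym: "mat_adjoint S = S"
  shows "char_poly S = (\<Prod>e\<leftarrow>eigenvalues_desc S. [:- e, 1:])" "length (eigenvalues_desc S) = n"
    "sorted_wrt (\<ge>) (eigenvalues_desc S)"
proof -
  interpret p: map_poly_inj_comm_ring_hom complex_of_real ..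
  let ?A = "map_mat complex_of_real S"
  have A: "?A \<in> carrier_mat n n" using S by simp
  have hA: "mat_adjoint ?A = ?A"
  proof (rule eq_matI)
    fix i j assume "i < dim_row ?A" "j < dim_col ?A"
    then show "mat_adjoint ?A $$ (i, j) = ?A $$ (i, j)"
      using arg_cong[OF sym, of "\<lambda>M. M $$ (i, j)"] S by simp
  qed (use S in auto)
  obtain U e where U: "U \<in> carrier_mat n n" "mat_adjoint U * U = 1\<^sub>m n"
    and cp: "char_poly ?A = (\<Prod>k\<leftarrow>[0..<n]. [:- e k, 1:])"
    and Ae: "\<And>i j. i < n \<Longrightarrow> j < n \<Longrightarrow> ?A $$ (i, j) = (\<Sum>k<n. U $$ (i, k) * e k * cnj (U $$ (j, k)))"
    using hermitian_spectral_complex[OF A hA] by blast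
  have er: "e k = of_real (Re (e k))" if "k < n" for k
    using hermitian_eigenvalue_real(2)[OF A hA U Ae that] by (simp add: complex_eq_iff complex_is_Real_iff)
  have "map_poly complex_of_real (char_poly S) = (\<Prod>k\<leftarrow>[0..<n]. [:- e k, 1:])"
    using cp of_real_hom.char_poly_hom[OF S, where 'a = complex] by simp
  also have "\<dots> = (\<Prod>k\<leftarrow>[0..<n]. map_poly complex_of_real [:- Re (e k), 1:])"
    using er by (intro arg_cong[of _ _ prod_list] map_cong refl) auto
  also have "\<dots> = map_poly complex_of_real (\<Prod>k\<leftarrow>[0..<n]. [:- Re (e k), 1:])"
    by (simp add: p.hom_prod_list o_def)
  finally have cr: "char_poly S = (\<Prod>k\<leftarrow>[0..<n]. [:- Re (e k), 1:])"
    by (rule p.injectivity)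
  define rs where "rs = map (\<lambda>k. Re (e k)) [0..<n]"
  have cr: "char_poly S = (\<Prod>r\<leftarrow>rs. [:- r, 1:])"
    unfolding cr rs_def by (simp add: o_def)
  have m: "mset (eigenvalues_desc S) = mset rs"
    unfolding eigenvalues_desc_def cr proots_linear_prod by simp
  show "length (eigenvalues_desc S) = n" using mset_eq_length[OF m] by (simp add: rs_def)
  show "char_poly S = (\<Prod>e\<leftarrow>eigenvalues_desc S. [:- e, 1:])"
    unfolding cr prod_mset_prod_list[symmetric] mset_map m ..
  show "sorted_wrt (\<ge>) (eigenvalues_desc S)"
    unfolding eigenvalues_desc_def sorted_wrt_rev by simp
qed

text \<open>The value \<open>x m\<close> separates the two parts of the decreasing sequence.\<close>

lemma weighted_sum_tail_bound:
  fixes x w :: "nat \<Rightarrow> real"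
  assumes anti: "\<And>i j. i \<le> j \<Longrightarrow> j < n \<Longrightarrow> x j \<le> x i" and pos: "\<And>i. i < n \<Longrightarrow> 0 \<le> x i"
    and w: "\<And>i. i < n \<Longrightarrow> 0 \<le> w i" "\<And>i. i < n \<Longrightarrow> w i \<le> 1" "(\<Sum>i<n. w i) \<le> m" and m: "m < n"
  shows "(\<Sum>i=m..<n. x i) \<le> (\<Sum>i<n. x i * (1 - w i))"
proof -
  have split: "(\<Sum>i<n. f i) = (\<Sum>i<m. f i) + (\<Sum>i=m..<n. f i)" for f :: "nat \<Rightarrow> real"
    using m by (simp add: lessThan_atLeast0 sum.atLeastLessThan_concat)
  have "(\<Sum>i=m..<n. x i * w i) \<le> (\<Sum>i=m..<n. x m * w i)"
    using anti w by (intro sum_mono mult_right_mono) auto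
  also have "\<dots> = x m * (\<Sum>i=m..<n. w i)" by (simp add: sum_distrib_left)
  \<comment> \<open>Since the total weight is at most \<open>m\<close>, the weight in the tail is at
    most what the first \<open>m\<close> weights lack to 1.\<close>
  also have "\<dots> \<le> x m * (\<Sum>i<m. 1 - w i)"
    using w(3) pos[OF m] by (intro mult_left_mono) (auto simp: split[of w] sum_subtractf)
  also have "\<dots> = (\<Sum>i<m. x m * (1 - w i))" by (simp add: sum_distrib_left)
  also have "\<dots> \<le> (\<Sum>i<m. x i * (1 - w i))"
    using anti w m by (intro sum_mono mult_right_mono) auto
  finally show ?thesis
    unfolding split[of "\<lambda>i. x i * (1 - w i)"] by (simp add: right_diff_distrib sum_subtractf)
qed

text \<open>The formula for \<eta> says that the eigenvalue is the squared length of the transpose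
  of \<open>K\<close> applied to the \<open>l\<close>-th eigenvector. It yields non-negativity and
  shows that a zero eigenvalue makes this vector vanish.\<close>

lemma mult_transpose_spectral:
  fixes K :: "real mat"
  assumes K: "K \<in> carrier_mat n n"
  defines "\<eta> \<equiv> \<lambda>l. eigenvalues_desc (K * transpose_mat K) ! l"
  obtains U where "U \<in> carrier_mat n n" "mat_adjoint U * U = 1\<^sub>m n"
    "\<And>i j. i < n \<Longrightarrow> j < n \<Longrightarrow> (\<Sum>a<n. K $$ (i, a) * K $$ (j, a)) = (\<Sum>l<n. U $$ (i, l) * \<eta> l * U $$ (j, l))"
    "\<And>l. l < n \<Longrightarrow> \<eta> l = (\<Sum>a<n. (\<Sum>i<n. U $$ (i, l) * K $$ (i, a))\<^sup>2)"
    "\<And>i j. i \<le> j \<Longrightarrow> j < n \<Longrightarrow> \<eta> j \<le> \<eta> i"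
proof -
  let ?S = "K * transpose_mat K"
  have S: "?S \<in> carrier_mat n n" using K by simp
  have Se: "?S $$ (i, j) = (\<Sum>a<n. K $$ (i, a) * K $$ (j, a))" if "i < n" "j < n" for i j
    using K that by (simp add: scalar_prod_def atLeast0LessThan)
  have hS: "mat_adjoint ?S = ?S"
    by (rule eq_matI) (use K in \<open>auto simp: scalar_prod_def mult.commute\<close>)
  note cp = symmetric_char_poly[OF S hS]
  obtain U where U: "U \<in> carrier_mat n n" "mat_adjoint U * U = 1\<^sub>m n"
    and US: "\<And>i j. i < n \<Longrightarrow> j < n \<Longrightarrow> ?S $$ (i, j) = (\<Sum>l<n. U $$ (i, l) * \<eta> l * conjugate (U $$ (j, l)))"
    using hermitian_spectral[OF real_pos_norm_sq S hS cp(1)] unfolding \<eta>_def by blast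
  have 1: "(\<Sum>a<n. K $$ (i, a) * K $$ (j, a)) = (\<Sum>l<n. U $$ (i, l) * \<eta> l * U $$ (j, l))" if "i < n" "j < n" for i j
    using Se[OF that] US[OF that] by simp
  note orth = unitary_column_entries(1)[OF U]
  have 2: "\<eta> l = (\<Sum>a<n. (\<Sum>i<n. U $$ (i, l) * K $$ (i, a))\<^sup>2)" if l: "l < n" for l
  proof -
    have "(\<Sum>a<n. (\<Sum>i<n. U $$ (i, l) * K $$ (i, a))\<^sup>2)
      = (\<Sum>a<n. \<Sum>i<n. \<Sum>j<n. U $$ (i, l) * U $$ (j, l) * (K $$ (i, a) * K $$ (j, a)))"
      unfolding power2_eq_square sum_product by (simp add: ac_simps)
    also have "\<dots> = (\<Sum>i<n. \<Sum>j<n. U $$ (i, l) * U $$ (j, l) * (\<Sum>a<n. K $$ (i, a) * K $$ (j, a)))"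
      unfolding sum_distrib_left by (rule sum_rotate[symmetric])
    also have "\<dots> = (\<Sum>i<n. \<Sum>j<n. \<Sum>k<n. U $$ (i, l) * U $$ (i, k) * \<eta> k * (U $$ (j, k) * U $$ (j, l)))"
      by (intro sum.cong refl) (simp add: 1 sum_distrib_left ac_simps)
    also have "\<dots> = (\<Sum>k<n. \<Sum>i<n. \<Sum>j<n. U $$ (i, l) * U $$ (i, k) * \<eta> k * (U $$ (j, k) * U $$ (j, l)))"
      by (rule sum_rotate)
    also have "\<dots> = (\<Sum>k<n. \<eta> k * (\<Sum>i<n. conjugate (U $$ (i, l)) * U $$ (i, k)) * (\<Sum>j<n. conjugate (U $$ (j, k)) * U $$ (j, l)))"
      by (simp add: sum_product sum_distrib_left sum_distrib_right ac_simps)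
    also have "\<dots> = (\<Sum>k<n. if k = l then \<eta> l else 0)"
      by (intro sum.cong refl) (use l in \<open>simp only: orth lessThan_iff, simp\<close>)
    finally show ?thesis using l by simp
  qed
  have "\<eta> j \<le> \<eta> i" if "i \<le> j" "j < n" for i j
    using sorted_wrt_nth_less[OF cp(3), of i j] that cp(2) unfolding \<eta>_def by (cases "i = j") auto
  then show ?thesis using that[OF U 1 2] by blast
qed

text \<open>By completeness of the columns of \<open>U\<close>, the matrix \<open>K\<close> is a sum
  of \<open>n\<close> products, one for each column; those with \<open>l \<ge> m\<close> vanish,
  which leaves \<open>m\<close> terms of rank at most one.\<close>

lemma rank_le_if_eigenvalues_zero:
  fixes K U :: "real mat"
  assumes K: "K \<in> carrier_mat n n" and U: "U \<in> carrier_mat n n" "mat_adjoint U * U = 1\<^sub>m n"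
    and zero: "\<And>l. m \<le> l \<Longrightarrow> l < n \<Longrightarrow> (\<Sum>a<n. (\<Sum>i<n. U $$ (i, l) * K $$ (i, a))\<^sup>2) = 0" and m: "m \<le> n"
  shows "vec_space.rank n K \<le> m"
proof (rule vec_space.rank_le_sum_product_entries[OF K])
  fix r c assume rc: "r < n" "c < n"
  define y where "y l = (\<Sum>i<n. U $$ (i, l) * K $$ (i, c))" for l
  have y0: "y l = 0" if "m \<le> l" "l < n" for l
    using zero[OF that] rc(2) unfolding y_def by (subst (asm) sum_nonneg_eq_0_iff) auto
  have "(\<Sum>l<m. U $$ (r, l) * y l) = (\<Sum>l<n. U $$ (r, l) * y l)"
    using m y0 by (intro sum.mono_neutral_left) auto
  also have "\<dots> = (\<Sum>i<n. (\<Sum>l<n. U $$ (r, l) * conjugate (U $$ (i, l))) * K $$ (i, c))"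
    unfolding y_def by (simp add: sum_distrib_left sum_distrib_right ac_simps, rule sum.swap)
  also have "\<dots> = (\<Sum>i<n. if i = r then K $$ (r, c) else 0)"
    by (intro sum.cong refl) (use rc in \<open>simp only: unitary_column_entries(2)[OF U] lessThan_iff, simp\<close>)
  finally show "K $$ (r, c) = (\<Sum>l<m. U $$ (r, l) * (\<Sum>i<n. U $$ (i, l) * K $$ (i, c)))"
    using rc(1) by (simp add: y_def)
qed

section \<open>The effect of a local measurement\<close>

text \<open>Separates the two factors in sums over the indices of a tensor product.\<close>

lemma sum_lessThan_mult:
  fixes f :: "nat \<Rightarrow> 'a :: comm_monoid_add"
  shows "(\<Sum>x<n * m. f x) = (\<Sum>i<n. \<Sum>j<m. f (i * m + j))"
proof -
  have "(\<Sum>x=i * m..<i * m + m. f x) = (\<Sum>j<m. f (i * m + j))" for i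
    using sum.shift_bounds_nat_ivl[of f 0 "i * m" m] by (simp add: atLeast0LessThan add.commute)
  then show ?thesis by (simp add: sum.nat_group[symmetric])
qed

lemma pair_index: "a * d + s < d * d" "(a * d + s) div d = a" "(a * d + s) mod d = s"
  if "a < d" "s < d" for a d s :: nat
proof -
  have "Suc a * d \<le> d * d" using that(1) by (intro mult_right_mono) auto
  then show "a * d + s < d * d" using that(2) by simp
qed (use that in auto)

lemma tensor_carrier: "A \<in> carrier_mat n m \<Longrightarrow> B \<in> carrier_mat k l \<Longrightarrow> A \<otimes>\<^sub>m B \<in> carrier_mat (n * k) (m * l)"
  unfolding tensor_mat_def by auto

lemma tensor_index:
  assumes "A \<in> carrier_mat d d" "B \<in> carrier_mat d d" "a < d" "b < d" "s < d" "t < d"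
  shows "(A \<otimes>\<^sub>m B) $$ (a * d + s, b * d + t) = A $$ (a, b) * B $$ (s, t)"
  using assms pair_index[of a d s] pair_index[of b d t] by (simp add: tensor_mat_def)

lemma tensor_one_mult_index:
  fixes A :: "complex mat"
  assumes A: "A \<in> carrier_mat d d" and M: "M \<in> carrier_mat (d * d) m" and i: "a < d" "s < d" "y < m"
  shows "((A \<otimes>\<^sub>m 1\<^sub>m d) * M) $$ (a * d + s, y) = (\<Sum>p<d. A $$ (a, p) * M $$ (p * d + s, y))"
proof -
  have "((A \<otimes>\<^sub>m 1\<^sub>m d) * M) $$ (a * d + s, y) =
    (\<Sum>x<d * d. (A \<otimes>\<^sub>m 1\<^sub>m d) $$ (a * d + s, x) * M $$ (x, y))"
    using tensor_carrier[OF A one_carrier_mat, of d] M i pair_index[OF i(1,2)]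
    by (simp add: scalar_prod_def atLeast0LessThan)
  also have "\<dots> = (\<Sum>p<d. \<Sum>u<d. if u = s then A $$ (a, p) * M $$ (p * d + s, y) else 0)"
    unfolding sum_lessThan_mult using A i by (intro sum.cong refl) (auto simp: tensor_index)
  finally show ?thesis using i by simp
qed

lemma mult_tensor_one_index:
  fixes A :: "complex mat"
  assumes A: "A \<in> carrier_mat d d" and M: "M \<in> carrier_mat m (d * d)" and i: "b < d" "t < d" "y < m"
  shows "(M * (A \<otimes>\<^sub>m 1\<^sub>m d)) $$ (y, b * d + t) = (\<Sum>q<d. M $$ (y, q * d + t) * A $$ (q, b))"
proof -
  have "(M * (A \<otimes>\<^sub>m 1\<^sub>m d)) $$ (y, b * d + t) =
    (\<Sum>x<d * d. M $$ (y, x) * (A \<otimes>\<^sub>m 1\<^sub>m d) $$ (x, b * d + t))"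
    using tensor_carrier[OF A one_carrier_mat, of d] M i pair_index[OF i(1,2)]
    by (simp add: scalar_prod_def atLeast0LessThan)
  also have "\<dots> = (\<Sum>q<d. \<Sum>u<d. if u = t then M $$ (y, q * d + t) * A $$ (q, b) else 0)"
    unfolding sum_lessThan_mult using A i by (intro sum.cong refl) (auto simp: tensor_index)
  finally show ?thesis using i by simp
qed

text \<open>The operators \<open>P k \<otimes>\<^sub>m 1\<^sub>m d\<close> act on the first index
  only. For fixed \<open>s\<close> and \<open>t\<close> the entries of \<open>R\<close> thus form a
  \<open>d\<close>-dimensional matrix that is simply pinched.\<close>

lemma local_measurement_index:
  assumes P: "\<And>k. k \<in> {1..d} \<Longrightarrow> P k \<in> carrier_mat d d" and R: "R \<in> carrier_mat (d * d) (d * d)"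
    and i: "a < d" "b < d" "s < d" "t < d"
  shows "local_measurement d P R $$ (a * d + s, b * d + t) =
    pinching d P (mat d d (\<lambda>(p, q). R $$ (p * d + s, q * d + t))) $$ (a, b)"
proof -
  let ?B = "mat d d (\<lambda>(p, q). R $$ (p * d + s, q * d + t))"
  have "((P k \<otimes>\<^sub>m 1\<^sub>m d) * R * (P k \<otimes>\<^sub>m 1\<^sub>m d)) $$ (a * d + s, b * d + t) = (P k * ?B * P k) $$ (a, b)"
    if k: "k \<in> {1..d}" for k
  proof -
    note Pk = P[OF k] and T = tensor_carrier[OF P[OF k] one_carrier_mat, of d]
    have "((P k \<otimes>\<^sub>m 1\<^sub>m d) * R * (P k \<otimes>\<^sub>m 1\<^sub>m d)) $$ (a * d + s, b * d + t)
      = (\<Sum>q<d. (\<Sum>p<d. P k $$ (a, p) * R $$ (p * d + s, q * d + t)) * P k $$ (q, b))"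
      using i pair_index[of a d s] pair_index[of _ d t]
      by (subst mult_tensor_one_index[OF Pk mult_carrier_mat[OF T R]])
        (auto simp: tensor_one_mult_index[OF Pk R] intro!: sum.cong)
    also have "\<dots> = (\<Sum>q<d. (P k * ?B) $$ (a, q) * P k $$ (q, b))"
      using Pk i by (auto simp: scalar_prod_def atLeast0LessThan intro!: sum.cong)
    also have "\<dots> = (P k * ?B * P k) $$ (a, b)"
      using mult_carrier_mat[OF Pk, of ?B d] Pk i
      by (simp add: scalar_prod_def atLeast0LessThan del: assoc_mult_mat)
    finally show ?thesis .
  qed
  then show ?thesis
    using i pair_index[of a d s] pair_index[of b d t] unfolding local_measurement_def pinching_def by simp
qed

section \<open>Linear combinations of generators and the entries of the state\<close>

lemma generator_cnj:
  assumes "i < d\<^sup>2 - 1" "a < d" "b < d"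
  shows "cnj (generator d (Suc i) $$ (a, b)) = generator d (Suc i) $$ (b, a)"
  using arg_cong[OF generator_adjoint[of "Suc i" d], of "\<lambda>M. M $$ (b, a)"] assms carrier_matD[OF generator_carrier]
  by simp

text \<open>\<open>\<langle>y, \<lambda>\<rangle>\<close> for a coefficient sequence counted from 0.\<close>

definition gen_comb :: "nat \<Rightarrow> (nat \<Rightarrow> real) \<Rightarrow> complex mat" where
  "gen_comb d y = sum_square_mats d {..<d\<^sup>2 - 1} (\<lambda>i. of_real (y i) \<cdot>\<^sub>m generator d (Suc i))"

lemma gen_comb_carrier [simp]: "gen_comb d y \<in> carrier_mat d d"
  and gen_comb_dim [simp]: "dim_row (gen_comb d y) = d" "dim_col (gen_comb d y) = d"
  unfolding gen_comb_def sum_square_mats_def by auto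

lemma gen_comb_index:
  assumes "a < d" "b < d"
  shows "gen_comb d y $$ (a, b) = (\<Sum>i<d\<^sup>2 - 1. of_real (y i) * generator d (Suc i) $$ (a, b))"
  unfolding gen_comb_def using assms carrier_matD[OF generator_carrier] by simp

lemma generator_comb_vec: "generator_comb d (vec (d\<^sup>2 - 1) y) = gen_comb d y"
proof (rule eq_matI)
  fix a b assume "a < dim_row (gen_comb d y)" "b < dim_col (gen_comb d y)"
  then have ab: "a < d" "b < d" by auto
  have "{1..d\<^sup>2 - 1} = Suc ` {..<d\<^sup>2 - 1}" by (simp add: image_Suc_lessThan)
  then show "generator_comb d (vec (d\<^sup>2 - 1) y) $$ (a, b) = gen_comb d y $$ (a, b)"
    using ab carrier_matD[OF generator_carrier] by (simp add: generator_comb_def gen_comb_index sum.reindex)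
qed (auto simp: generator_comb_def sum_square_mats_def)

lemma gen_comb_adjoint: "mat_adjoint (gen_comb d y) = gen_comb d y"
  by (rule eq_matI) (auto simp: gen_comb_index generator_cnj intro!: sum.cong)

lemma tr_mult_gen_comb:
  assumes "A \<in> carrier_mat d d"
  shows "tr (A * gen_comb d y) = (\<Sum>i<d\<^sup>2 - 1. of_real (y i) * tr (A * generator d (Suc i)))"
  unfolding gen_comb_def using assms
  by (subst tr_mult_sum_square_mats)
    (auto simp: mult_smult_distrib[of _ d d _ d] tr_smult[of _ d] mult_carrier_mat[of _ d d _ d] intro!: sum.cong)

text \<open>Conjugation transposes a generator, so the sum over \<open>s\<close> and
  \<open>t\<close> turns into traces of products of generators, which are 0 or 2. The coefficients
  are complex because they will be matrix entries of the first tensor factor.\<close>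

lemma generator_parseval:
  fixes y :: "nat \<Rightarrow> complex"
  shows "(\<Sum>s<d. \<Sum>t<d. (cmod (\<Sum>j<d\<^sup>2 - 1. y j * generator d (Suc j) $$ (s, t)))\<^sup>2) = 2 * (\<Sum>j<d\<^sup>2 - 1. (cmod (y j))\<^sup>2)"
proof -
  let ?L = "\<lambda>j. generator d (Suc j)" and ?N = "d\<^sup>2 - 1"
  have "complex_of_real (\<Sum>s<d. \<Sum>t<d. (cmod (\<Sum>j<?N. y j * ?L j $$ (s, t)))\<^sup>2)
    = (\<Sum>s<d. \<Sum>t<d. \<Sum>j<?N. \<Sum>l<?N. y j * cnj (y l) * (?L j $$ (s, t) * ?L l $$ (t, s)))"
    unfolding of_real_sum complex_norm_square cnj_sum sum_product
    by (intro sum.cong refl) (simp add: generator_cnj ac_simps)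
  also have "\<dots> = (\<Sum>s<d. \<Sum>j<?N. \<Sum>l<?N. \<Sum>t<d. y j * cnj (y l) * (?L j $$ (s, t) * ?L l $$ (t, s)))"
    by (intro sum.cong refl sum_rotate[symmetric])
  also have "\<dots> = (\<Sum>j<?N. \<Sum>l<?N. \<Sum>s<d. \<Sum>t<d. y j * cnj (y l) * (?L j $$ (s, t) * ?L l $$ (t, s)))"
    by (rule sum_rotate[symmetric])
  also have "\<dots> = (\<Sum>j<?N. \<Sum>l<?N. y j * cnj (y l) * tr (?L j * ?L l))"
    by (simp add: tr_mult_entries[of _ d d] sum_distrib_left)
  also have "\<dots> = (\<Sum>j<?N. \<Sum>l<?N. if l = j then 2 * (y j * cnj (y j)) else 0)"
    by (intro sum.cong refl) (auto simp: tr_generator_mult)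
  also have "\<dots> = complex_of_real (2 * (\<Sum>j<?N. (cmod (y j))\<^sup>2))"
    by (simp add: complex_norm_square sum_distrib_left del: of_real_power)
  finally show ?thesis by (simp only: of_real_eq_iff)
qed

lemma norm2_gen_comb: "(norm2 (gen_comb d y))\<^sup>2 = 2 * (\<Sum>i<d\<^sup>2 - 1. (y i)\<^sup>2)"
  using generator_parseval[where d = d and y = "\<lambda>i. of_real (y i)"]
  unfolding norm2_sq[OF gen_comb_carrier]
  by (subst sum.swap) (simp add: gen_comb_index)

lemma lmm_operator_index:
  assumes K: "K \<in> carrier_mat (d\<^sup>2 - 1) (d\<^sup>2 - 1)" and i: "a < d" "b < d" "s < d" "t < d"
  shows "lmm_operator d K $$ (a * d + s, b * d + t) = (1 / of_nat (d\<^sup>2)) * ((if a = b \<and> s = t then 1 else 0) +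
    (\<Sum>j<d\<^sup>2 - 1. gen_comb d (\<lambda>i. K $$ (i, j)) $$ (a, b) * generator d (Suc j) $$ (s, t)))"
proof -
  let ?N = "d\<^sup>2 - 1"
  have e: "generator_comb d (unit_vec ?N j) = generator d (Suc j)" if "j < ?N" for j
  proof -
    have u: "unit_vec ?N j = vec ?N (\<lambda>i. if i = j then 1 else 0 :: real)"
      by (auto simp: unit_vec_def)
    have "gen_comb d (\<lambda>i. if i = j then 1 else 0) = generator d (Suc j)"
    proof (rule eq_matI)
      fix a b assume "a < dim_row (generator d (Suc j))" "b < dim_col (generator d (Suc j))"
      then have ab: "a < d" "b < d" using carrier_matD[OF generator_carrier] by auto
      have "gen_comb d (\<lambda>i. if i = j then 1 else 0) $$ (a, b) =
          (\<Sum>i<?N. if i = j then generator d (Suc j) $$ (a, b) else 0)"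
        unfolding gen_comb_index[OF ab] by (intro sum.cong) auto
      then show "gen_comb d (\<lambda>i. if i = j then 1 else 0) $$ (a, b) = generator d (Suc j) $$ (a, b)"
        using that by simp
    qed (use carrier_matD[OF generator_carrier] in auto)
    then show ?thesis unfolding u generator_comb_vec .
  qed
  have Ke: "generator_comb d (K *\<^sub>v unit_vec ?N j) = gen_comb d (\<lambda>i. K $$ (i, j))" if "j < ?N" for j
  proof -
    have "K *\<^sub>v unit_vec ?N j = vec ?N (\<lambda>i. K $$ (i, j))"
      using K that by (intro eq_vecI) auto
    then show ?thesis by (simp only: generator_comb_vec)
  qed
  have img: "{1..?N} = Suc ` {..<?N}" by (simp add: image_Suc_lessThan)
  let ?T = "\<lambda>j. generator_comb d (K *\<^sub>v unit_vec ?N (j - 1)) \<otimes>\<^sub>m generator_comb d (unit_vec ?N (j - 1))"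
  have T: "?T (Suc j) $$ (a * d + s, b * d + t) = gen_comb d (\<lambda>i. K $$ (i, j)) $$ (a, b) * generator d (Suc j) $$ (s, t)"
    if "j < ?N" for j
    unfolding diff_Suc_1 Ke[OF that] e[OF that] using i by (intro tensor_index) auto
  have "sum_square_mats (d * d) {1..?N} ?T $$ (a * d + s, b * d + t) = (\<Sum>j<?N. ?T (Suc j) $$ (a * d + s, b * d + t))"
    using i pair_index(1)[of a d s] pair_index(1)[of b d t] unfolding img by (simp add: sum.reindex)
  also have "\<dots> = (\<Sum>j<?N. gen_comb d (\<lambda>i. K $$ (i, j)) $$ (a, b) * generator d (Suc j) $$ (s, t))"
    by (intro sum.cong refl T) auto
  finally have "sum_square_mats (d * d) {1..?N} ?T $$ (a * d + s, b * d + t)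
    = (\<Sum>j<?N. gen_comb d (\<lambda>i. K $$ (i, j)) $$ (a, b) * generator d (Suc j) $$ (s, t))" .
  then show ?thesis
    using i pair_index[of a d s] pair_index[of b d t] tensor_carrier[OF one_carrier_mat[of d] one_carrier_mat[of d]]
    unfolding lmm_operator_def by (subst index_smult_mat) (auto simp: tensor_index carrier_matD[OF sum_square_mats_carrier])
qed

section \<open>The state minus the measured state\<close>

lemma lmm_operator_carrier [simp]: "lmm_operator d K \<in> carrier_mat (d * d) (d * d)"
  unfolding lmm_operator_def by (intro smult_carrier_mat add_carrier_mat) auto

lemma local_measurement_carrier [simp]: "local_measurement d P R \<in> carrier_mat (d * d) (d * d)"
  unfolding local_measurement_def by simp

lemma pinching_index:
  assumes "\<And>k. k \<in> {1..d} \<Longrightarrow> P k \<in> carrier_mat d d" "X \<in> carrier_mat d d" "a < d" "b < d"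
  shows "pinching d P X $$ (a, b) = (\<Sum>k\<in>{1..d}. \<Sum>p<d. \<Sum>q<d. P k $$ (a, p) * (X $$ (p, q) * P k $$ (q, b)))"
proof -
  have "(P k * X * P k) $$ (a, b) = (\<Sum>p<d. \<Sum>q<d. P k $$ (a, p) * (X $$ (p, q) * P k $$ (q, b)))" if "k \<in> {1..d}" for k
    using assms(1)[OF that] assms(2-)
    by (auto simp: scalar_prod_def atLeast0LessThan sum_distrib_left intro!: sum.cong)
  then show ?thesis using assms(3,4) unfolding pinching_def by simp
qed

text \<open>Linearity of the pinching, in the form needed for the blocks of the state with fixed
  indices in the second factor.\<close>

lemma pinching_sum:
  fixes c :: "'i \<Rightarrow> complex"
  assumes P: "\<And>k. k \<in> {1..d} \<Longrightarrow> P k \<in> carrier_mat d d"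
    and Y: "\<And>j. j \<in> I \<Longrightarrow> Y j \<in> carrier_mat d d" and X: "X \<in> carrier_mat d d"
    and sum: "\<And>p q. p < d \<Longrightarrow> q < d \<Longrightarrow> X $$ (p, q) = (\<Sum>j\<in>I. c j * Y j $$ (p, q))"
    and ab: "a < d" "b < d"
  shows "pinching d P X $$ (a, b) = (\<Sum>j\<in>I. c j * pinching d P (Y j) $$ (a, b))"
proof -
  have idx: "pinching d P Z $$ (a, b) = (\<Sum>k\<in>{1..d}. \<Sum>p<d. \<Sum>q<d. P k $$ (a, p) * (Z $$ (p, q) * P k $$ (q, b)))"
    if "Z \<in> carrier_mat d d" for Z
    using P that ab by (rule pinching_index)
  have "pinching d P X $$ (a, b) =
    (\<Sum>k\<in>{1..d}. \<Sum>p<d. \<Sum>q<d. \<Sum>j\<in>I. c j * (P k $$ (a, p) * (Y j $$ (p, q) * P k $$ (q, b))))"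
    unfolding idx[OF X]
    by (intro sum.cong refl) (simp add: sum sum_distrib_left sum_distrib_right ac_simps)
  also have "\<dots> = (\<Sum>k\<in>{1..d}. \<Sum>j\<in>I. \<Sum>p<d. \<Sum>q<d. c j * (P k $$ (a, p) * (Y j $$ (p, q) * P k $$ (q, b))))"
    by (intro sum.cong refl sum_rotate)
  also have "\<dots> = (\<Sum>j\<in>I. \<Sum>k\<in>{1..d}. \<Sum>p<d. \<Sum>q<d. c j * (P k $$ (a, p) * (Y j $$ (p, q) * P k $$ (q, b))))"
    by (rule sum.swap)
  also have "\<dots> = (\<Sum>j\<in>I. c j * pinching d P (Y j) $$ (a, b))"
    by (intro sum.cong refl) (simp add: idx[OF Y] sum_distrib_left)
  finally show ?thesis .
qed

lemma pinching_one:
  assumes P: "projective_measurement d P"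
  shows "pinching d P (1\<^sub>m d) = 1\<^sub>m d"
proof -
  have "P k * 1\<^sub>m d * P k = P k" if "k \<in> {1..d}" for k
    using measurement_projector[OF P that] by simp
  then have "pinching d P (1\<^sub>m d) = sum_square_mats d {1..d} P"
    unfolding pinching_def sum_square_mats_def by (intro cong_mat refl) (auto intro!: sum.cong)
  then show ?thesis using P unfolding projective_measurement_def by simp
qed

text \<open>The pinching fixes the identity, so the identity component cancels and only the
  generator terms remain, each pinched in its first factor.\<close>

lemma lmm_diff_measurement_index:
  assumes K: "K \<in> carrier_mat (d\<^sup>2 - 1) (d\<^sup>2 - 1)" and P: "projective_measurement d P"
    and i: "a < d" "b < d" "s < d" "t < d"
  defines "X \<equiv> \<lambda>j. gen_comb d (\<lambda>i. K $$ (i, j))"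
  shows "(lmm_operator d K - local_measurement d P (lmm_operator d K)) $$ (a * d + s, b * d + t) =
    1 / of_nat (d\<^sup>2) * (\<Sum>j<d\<^sup>2 - 1. (X j - pinching d P (X j)) $$ (a, b) * generator d (Suc j) $$ (s, t))"
proof -
  let ?R = "lmm_operator d K" and ?N = "d\<^sup>2 - 1" and ?c = "1 / of_nat (d\<^sup>2) :: complex"
  let ?B = "mat d d (\<lambda>(p, q). ?R $$ (p * d + s, q * d + t))"
  note Pc = measurement_projector(1)[OF P]
  have Xc: "X j \<in> carrier_mat d d" for j unfolding X_def by simp
  \<comment> \<open>\<open>None\<close> stands for the identity component and \<open>Some j\<close>
    for the term of the generator with index \<open>Suc j\<close>; so a single use of linearity
    covers the whole block.\<close>
  define Y where "Y j = (case j of None \<Rightarrow> 1\<^sub>m d | Some j \<Rightarrow> X j)" for j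
  define c where "c j = (case j of None \<Rightarrow> if s = t then ?c else 0 | Some j \<Rightarrow> ?c * generator d (Suc j) $$ (s, t))" for j
  let ?I = "insert None (Some ` {..<?N})"
  have sI: "(\<Sum>j\<in>?I. f j) = f None + (\<Sum>j<?N. f (Some j))" for f :: "nat option \<Rightarrow> complex"
    by (subst sum.insert) (auto simp: sum.reindex)
  have B: "?B $$ (p, q) = (\<Sum>j\<in>?I. c j * Y j $$ (p, q))" if "p < d" "q < d" for p q
    unfolding sI using lmm_operator_index[OF K that i(3,4)] that
    by (simp add: c_def Y_def X_def ring_distribs sum_distrib_left mult.assoc mult.left_commute mult.commute)
  have "local_measurement d P ?R $$ (a * d + s, b * d + t) = pinching d P ?B $$ (a, b)"
    by (rule local_measurement_index[OF Pc lmm_operator_carrier i])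
  also have "\<dots> = (\<Sum>j\<in>?I. c j * pinching d P (Y j) $$ (a, b))"
    by (rule pinching_sum[OF Pc _ _ B i(1,2)]) (auto simp: Y_def Xc)
  finally have M: "local_measurement d P ?R $$ (a * d + s, b * d + t) = (\<Sum>j\<in>?I. c j * pinching d P (Y j) $$ (a, b))" .
  have "?R $$ (a * d + s, b * d + t) = (\<Sum>j\<in>?I. c j * Y j $$ (a, b))"
    using B[OF i(1,2)] i by simp
  then have "(?R - local_measurement d P ?R) $$ (a * d + s, b * d + t)
    = (\<Sum>j\<in>?I. c j * Y j $$ (a, b)) - (\<Sum>j\<in>?I. c j * pinching d P (Y j) $$ (a, b))"
    using M pair_index(1)[OF i(1,3)] pair_index(1)[OF i(2,4)] carrier_matD[OF local_measurement_carrier[of d P ?R]]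
    by simp
  also have "\<dots> = (\<Sum>j<?N. c (Some j) * (X j $$ (a, b) - pinching d P (X j) $$ (a, b)))"
    unfolding sI by (simp add: Y_def pinching_one[OF P] sum_subtractf right_diff_distrib)
  also have "\<dots> = ?c * (\<Sum>j<?N. (X j - pinching d P (X j)) $$ (a, b) * generator d (Suc j) $$ (s, t))"
    using i carrier_matD[OF pinching_carrier] by (auto simp: c_def sum_distrib_left ac_simps intro!: sum.cong)
  finally show ?thesis .
qed

text \<open>The indices of the second factor are summed innermost, ready for
  \<open>generator_parseval\<close>.\<close>

lemma norm2_sq_tensor_index:
  assumes "R \<in> carrier_mat (d * d) (d * d)"
  shows "(norm2 R)\<^sup>2 = (\<Sum>b<d. \<Sum>a<d. \<Sum>s<d. \<Sum>t<d. (cmod (R $$ (a * d + s, b * d + t)))\<^sup>2)"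
proof -
  have "(norm2 R)\<^sup>2 = (\<Sum>b<d. \<Sum>t<d. \<Sum>a<d. \<Sum>s<d. (cmod (R $$ (a * d + s, b * d + t)))\<^sup>2)"
    unfolding norm2_sq[OF assms] sum_lessThan_mult ..
  also have "\<dots> = (\<Sum>b<d. \<Sum>a<d. \<Sum>s<d. \<Sum>t<d. (cmod (R $$ (a * d + s, b * d + t)))\<^sup>2)"
    by (intro sum.cong refl sum_rotate[symmetric])
  finally show ?thesis .
qed

text \<open>Parseval in the second factor decouples the index \<open>j\<close>, and
  \<open>norm2_diff_pinching\<close> evaluates each remaining term. The constant consists of the
  squared prefactor of the state and the squared norm 2 of a generator.\<close>

lemma norm2_lmm_diff_measurement:
  fixes K :: "real mat"
  assumes K: "K \<in> carrier_mat (d\<^sup>2 - 1) (d\<^sup>2 - 1)" and P: "projective_measurement d P"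
  defines "\<alpha> \<equiv> \<lambda>k i. Re (tr (P k * generator d (Suc i)))"
  shows "(norm2 (lmm_operator d K - local_measurement d P (lmm_operator d K)))\<^sup>2 =
    2 / real d ^ 4 * (\<Sum>j<d\<^sup>2 - 1. 2 * (\<Sum>i<d\<^sup>2 - 1. (K $$ (i, j))\<^sup>2) -
      (\<Sum>k\<in>{1..d}. (\<Sum>i<d\<^sup>2 - 1. K $$ (i, j) * \<alpha> k i)\<^sup>2))"
proof -
  let ?N = "d\<^sup>2 - 1" and ?c = "1 / of_nat (d\<^sup>2) :: complex"
  let ?R = "lmm_operator d K - local_measurement d P (lmm_operator d K)"
  define X where "X j = gen_comb d (\<lambda>i. K $$ (i, j))" for j
  define Y where "Y j = X j - pinching d P (X j)" for j
  have Y: "Y j \<in> carrier_mat d d" for j unfolding Y_def by (intro minus_carrier_mat) simp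
  have R: "?R \<in> carrier_mat (d * d) (d * d)" by (intro minus_carrier_mat) simp
  have YK: "(norm2 (Y j))\<^sup>2 = 2 * (\<Sum>i<?N. (K $$ (i, j))\<^sup>2) - (\<Sum>k\<in>{1..d}. (\<Sum>i<?N. K $$ (i, j) * \<alpha> k i)\<^sup>2)" for j
  proof -
    have "Re (tr (P k * X j)) = (\<Sum>i<?N. K $$ (i, j) * \<alpha> k i)" if "k \<in> {1..d}" for k
      unfolding X_def tr_mult_gen_comb[OF measurement_projector(1)[OF P that]] \<alpha>_def by simp
    then show ?thesis
      unfolding Y_def by (subst norm2_diff_pinching[OF P]) (simp_all add: X_def gen_comb_adjoint norm2_gen_comb)
  qed
  have cm: "(cmod (?c * z))\<^sup>2 = 1 / real d ^ 4 * (cmod z)\<^sup>2" for z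
    by (simp add: norm_mult norm_divide power_mult_distrib power_divide norm_power flip: power_mult)
  have "(norm2 ?R)\<^sup>2 = (\<Sum>b<d. \<Sum>a<d. \<Sum>s<d. \<Sum>t<d. (cmod (?c * (\<Sum>j<?N. Y j $$ (a, b) * generator d (Suc j) $$ (s, t))))\<^sup>2)"
    unfolding norm2_sq_tensor_index[OF R] Y_def X_def
    by (intro sum.cong refl arg_cong[of _ _ "\<lambda>z. (cmod z)\<^sup>2"] lmm_diff_measurement_index[OF K P]) auto
  also have "\<dots> = (\<Sum>b<d. \<Sum>a<d. (1 / real d ^ 4) * (\<Sum>s<d. \<Sum>t<d. (cmod (\<Sum>j<?N. Y j $$ (a, b) * generator d (Suc j) $$ (s, t)))\<^sup>2))"
    unfolding cm by (simp only: sum_distrib_left)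
  also have "\<dots> = (\<Sum>b<d. \<Sum>a<d. \<Sum>j<?N. 2 / real d ^ 4 * (cmod (Y j $$ (a, b)))\<^sup>2)"
    unfolding generator_parseval by (simp add: sum_distrib_left)
  also have "\<dots> = (\<Sum>j<?N. \<Sum>b<d. \<Sum>a<d. 2 / real d ^ 4 * (cmod (Y j $$ (a, b)))\<^sup>2)"
    by (rule sum_rotate)
  also have "\<dots> = 2 / real d ^ 4 * (\<Sum>j<?N. (norm2 (Y j))\<^sup>2)"
    unfolding norm2_sq[OF Y] by (simp add: sum_distrib_left)
  also have "(\<Sum>j<?N. (norm2 (Y j))\<^sup>2) = (\<Sum>j<?N. 2 * (\<Sum>i<?N. (K $$ (i, j))\<^sup>2) - (\<Sum>k\<in>{1..d}. (\<Sum>i<?N. K $$ (i, j) * \<alpha> k i)\<^sup>2))"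
    by (simp only: YK)
  finally show ?thesis .
qed

section \<open>Bessel bounds for the projectors of a measurement\<close>

lemma measurement_tr_generator:
  assumes P: "projective_measurement d P" and k: "k \<in> {1..d}" and i: "i < d\<^sup>2 - 1"
  shows "tr (P k * generator d (Suc i)) = of_real (Re (tr (P k * generator d (Suc i))))"
proof -
  have "tr (P k * generator d (Suc i)) \<in> \<real>"
    using measurement_projector[OF P k] generator_adjoint[of "Suc i" d] i
    by (intro tr_hermitian_mult_real[of _ d]) auto
  then show ?thesis by (rule of_real_Re[symmetric])
qed

text \<open>Bessel's inequality for the identity and the generators, applied to \<open>P\<^sub>k\<close>, whose norm is 1.\<close>

lemma measurement_bloch_vector_bound:
  assumes P: "projective_measurement d P" and k: "k \<in> {1..d}"
  shows "(\<Sum>i<d\<^sup>2 - 1. (Re (tr (P k * generator d (Suc i))))\<^sup>2) \<le> 2 * (1 - 1 / real d)"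
proof -
  let ?N = "d\<^sup>2 - 1"
  note Pk = measurement_projector[OF P k]
  \<comment> \<open>Index 0 carries the identity, whose squared norm is \<open>d\<close>. As
    \<open>tr (P k) = 1\<close>, its term in Bessel's inequality is \<open>1 / d\<close>, which
    accounts for the loss in the bound.\<close>
  define F where "F m = (if m = 0 then 1\<^sub>m d else generator d m)" for m
  define c where "c m = (if m = 0 then real d else 2)" for m :: nat
  have d: "d > 0" using k by auto
  have tr1: "tr (1\<^sub>m d :: complex mat) = of_nat d" by (simp add: tr_def)
  have "(\<Sum>m\<in>{..?N}. (cmod (tr (F m * P k)))\<^sup>2 / c m) \<le> (norm2 (P k))\<^sup>2"
  proof (rule bessel_hermitian[OF _ _ _ _ _ Pk(1)])
    fix m l assume "m \<in> {..?N}" "l \<in> {..?N}"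
    then show "tr (F m * F l) = (if m = l then of_real (c m) else 0)"
      by (auto simp: F_def c_def tr1 tr_generator tr_generator_mult left_mult_one_mat[OF generator_carrier]
          right_mult_one_mat[OF generator_carrier])
  qed (use d in \<open>auto simp: F_def c_def generator_adjoint\<close>)
  also have "(norm2 (P k))\<^sup>2 = 1"
    using Pk unfolding norm2_def by simp
  also have "(\<Sum>m\<in>{..?N}. (cmod (tr (F m * P k)))\<^sup>2 / c m) = 1 / real d + (\<Sum>i<?N. (cmod (tr (P k * generator d (Suc i))))\<^sup>2 / 2)"
    using Pk by (subst sum.atMost_shift) (simp add: F_def c_def tr_comm[OF generator_carrier Pk(1)])
  also have "(\<Sum>i<?N. (cmod (tr (P k * generator d (Suc i))))\<^sup>2 / 2) = (\<Sum>i<?N. (Re (tr (P k * generator d (Suc i))))\<^sup>2) / 2"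
    unfolding sum_divide_distrib
    by (intro sum.cong refl) (subst measurement_tr_generator[OF P k], auto)
  finally show ?thesis by simp
qed

text \<open>The projectors are orthonormal for the trace inner product, and the matrix with
  coefficients \<open>y\<close> has squared norm twice that of \<open>y\<close>. For a unit vector
  \<open>y\<close> this bounds a weight by 1.\<close>

lemma measurement_bessel:
  assumes P: "projective_measurement d P"
  shows "(\<Sum>k\<in>{1..d}. (\<Sum>i<d\<^sup>2 - 1. y i * Re (tr (P k * generator d (Suc i))))\<^sup>2) \<le> 2 * (\<Sum>i<d\<^sup>2 - 1. (y i)\<^sup>2)"
proof -
  have "(\<Sum>k\<in>{1..d}. (cmod (tr (P k * gen_comb d y)))\<^sup>2 / 1) \<le> (norm2 (gen_comb d y))\<^sup>2"
    by (rule bessel_hermitian) (use measurement_projector[OF P] tr_measurement_mult[OF P] in auto)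
  moreover have "tr (P k * gen_comb d y) = of_real (\<Sum>i<d\<^sup>2 - 1. y i * Re (tr (P k * generator d (Suc i))))"
    if "k \<in> {1..d}" for k
    unfolding tr_mult_gen_comb[OF measurement_projector(1)[OF P that]] of_real_sum of_real_mult
    by (intro sum.cong refl) (subst measurement_tr_generator[OF P that], auto)
  ultimately show ?thesis by (simp add: norm2_gen_comb del: of_real_sum)
qed

section \<open>Bounds for the discord\<close>

text \<open>List positions count from 0, so the tail starts at \<open>d - 1\<close> and exactly the
  \<open>d - 1\<close> largest eigenvalues are left out.\<close>

lemma Xi_eq:
  assumes "0 < d"
  shows "Xi d K = (\<Sum>l=d - 1..<d\<^sup>2 - 1. eigenvalues_desc (K * transpose_mat K) ! l)"
proof -
  have "{d..d\<^sup>2 - 1} = Suc ` {d - 1..<d\<^sup>2 - 1}"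
    using assms zero_less_power[OF assms, of 2] by (auto simp: image_Suc_atLeastLessThan)
  then show ?thesis unfolding Xi_def by (simp only:, subst sum.reindex) auto
qed

lemma norm2_lmm_diff_measurement_ge:
  assumes d: "2 \<le> d" and K: "K \<in> carrier_mat (d\<^sup>2 - 1) (d\<^sup>2 - 1)" and P: "projective_measurement d P"
  shows "4 / real d ^ 4 * Xi d K \<le> (norm2 (lmm_operator d K - local_measurement d P (lmm_operator d K)))\<^sup>2"
proof -
  define N where "N = d\<^sup>2 - 1"
  note K = K[folded N_def]
  define \<eta> where "\<eta> l = eigenvalues_desc (K * transpose_mat K) ! l" for l
  define \<alpha> where "\<alpha> k i = Re (tr (P k * generator d (Suc i)))" for k i
  obtain U where U: "U \<in> carrier_mat N N" "mat_adjoint U * U = 1\<^sub>m N"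
    and KK: "\<And>i j. i < N \<Longrightarrow> j < N \<Longrightarrow> (\<Sum>a<N. K $$ (i, a) * K $$ (j, a)) = (\<Sum>l<N. U $$ (i, l) * \<eta> l * U $$ (j, l))"
    and \<eta>: "\<And>l. l < N \<Longrightarrow> \<eta> l = (\<Sum>a<N. (\<Sum>i<N. U $$ (i, l) * K $$ (i, a))\<^sup>2)"
    and anti: "\<And>i j. i \<le> j \<Longrightarrow> j < N \<Longrightarrow> \<eta> j \<le> \<eta> i"
    using mult_transpose_spectral[OF K] unfolding \<eta>_def by blast
  have colU: "(\<Sum>i<N. (U $$ (i, l))\<^sup>2) = 1" if "l < N" for l
    using unitary_column_entries(1)[OF U that that] by (simp add: power2_eq_square)
  define w where "w l = (\<Sum>k\<in>{1..d}. (\<Sum>i<N. U $$ (i, l) * \<alpha> k i)\<^sup>2) / 2" for l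
  have w1: "w l \<le> 1" if "l < N" for l
    using measurement_bessel[OF P, folded N_def, of "\<lambda>i. U $$ (i, l)"] colU[OF that] unfolding w_def \<alpha>_def by simp
  have w0: "0 \<le> w l" for l unfolding w_def by (simp add: sum_nonneg)
  \<comment> \<open>Passing to coordinates in the eigenbasis preserves lengths, since the rows of
    \<open>U\<close> are orthonormal.\<close>
  have parseval: "(\<Sum>l<N. (\<Sum>i<N. U $$ (i, l) * x i)\<^sup>2) = (\<Sum>i<N. (x i)\<^sup>2)" for x
  proof -
    have "(\<Sum>l<N. (\<Sum>i<N. U $$ (i, l) * x i)\<^sup>2) = (\<Sum>l<N. \<Sum>i<N. \<Sum>j<N. x i * x j * (U $$ (i, l) * U $$ (j, l)))"
      unfolding power2_eq_square sum_product by (simp add: ac_simps)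
    also have "\<dots> = (\<Sum>i<N. \<Sum>j<N. x i * x j * (\<Sum>l<N. U $$ (i, l) * conjugate (U $$ (j, l))))"
      unfolding sum_distrib_left conjugate_real_def by (rule sum_rotate[symmetric])
    also have "\<dots> = (\<Sum>i<N. \<Sum>j<N. if j = i then (x i)\<^sup>2 else 0)"
      by (intro sum.cong refl, subst unitary_column_entries(2)[OF U]) (auto simp: power2_eq_square)
    finally show ?thesis by simp
  qed
  have "(\<Sum>l<N. w l) = (\<Sum>k\<in>{1..d}. \<Sum>l<N. (\<Sum>i<N. U $$ (i, l) * \<alpha> k i)\<^sup>2) / 2"
    unfolding w_def by (subst sum.swap) (simp add: sum_divide_distrib)
  also have "\<dots> = (\<Sum>k\<in>{1..d}. \<Sum>i<N. (\<alpha> k i)\<^sup>2) / 2" by (simp only: parseval)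
  \<comment> \<open>There are \<open>d\<close> vectors \<alpha>, each of squared length at most
    \<open>2 * (1 - 1 / d)\<close>; half of the total is \<open>d - 1\<close>, the number of
    eigenvalues that can be cancelled.\<close>
  also have "\<dots> \<le> (\<Sum>k\<in>{1..d}. 2 * (1 - 1 / real d)) / 2"
    using measurement_bloch_vector_bound[OF P, folded N_def]
    unfolding \<alpha>_def by (intro divide_right_mono sum_mono) auto
  also have "\<dots> = real (d - 1)" using d by (simp add: field_simps of_nat_diff)
  finally have wsum: "(\<Sum>l<N. w l) \<le> real (d - 1)" .
  have UK: "(\<Sum>l<N. \<eta> l * (\<Sum>i<N. U $$ (i, l) * \<alpha> k i)\<^sup>2) = (\<Sum>j<N. (\<Sum>i<N. K $$ (i, j) * \<alpha> k i)\<^sup>2)" for k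
  proof -
    have "(\<Sum>j<N. (\<Sum>i<N. K $$ (i, j) * \<alpha> k i)\<^sup>2) = (\<Sum>j<N. \<Sum>i<N. \<Sum>h<N. \<alpha> k i * \<alpha> k h * (K $$ (i, j) * K $$ (h, j)))"
      unfolding power2_eq_square sum_product by (simp add: ac_simps)
    also have "\<dots> = (\<Sum>i<N. \<Sum>h<N. \<alpha> k i * \<alpha> k h * (\<Sum>j<N. K $$ (i, j) * K $$ (h, j)))"
      unfolding sum_distrib_left by (rule sum_rotate[symmetric])
    also have "\<dots> = (\<Sum>i<N. \<Sum>h<N. \<Sum>l<N. \<eta> l * ((U $$ (i, l) * \<alpha> k i) * (U $$ (h, l) * \<alpha> k h)))"
      by (intro sum.cong refl) (simp add: KK sum_distrib_left ac_simps)
    also have "\<dots> = (\<Sum>l<N. \<Sum>i<N. \<Sum>h<N. \<eta> l * ((U $$ (i, l) * \<alpha> k i) * (U $$ (h, l) * \<alpha> k h)))"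
      by (rule sum_rotate)
    also have "\<dots> = (\<Sum>l<N. \<eta> l * (\<Sum>i<N. U $$ (i, l) * \<alpha> k i)\<^sup>2)"
      unfolding power2_eq_square sum_product by (simp add: sum_distrib_left)
    finally show ?thesis ..
  qed
  have "d - 1 < N" unfolding N_def using d
    by (cases d) (auto simp: power2_eq_square)
  \<comment> \<open>The remaining steps rewrite the right-hand side back from the eigenbasis into
    entries of \<open>K\<close>.\<close>
  then have "Xi d K \<le> (\<Sum>l<N. \<eta> l * (1 - w l))"
    using d unfolding Xi_eq[of d K, folded N_def, OF less_le_trans[OF _ d, of 0, simplified]] \<eta>_def[symmetric]
    by (intro weighted_sum_tail_bound anti w0 w1 wsum) (auto simp: \<eta> sum_nonneg)
  also have "(\<Sum>l<N. \<eta> l * (1 - w l)) = (\<Sum>l<N. \<eta> l) - (\<Sum>k\<in>{1..d}. \<Sum>l<N. \<eta> l * (\<Sum>i<N. U $$ (i, l) * \<alpha> k i)\<^sup>2) / 2"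
    by (subst sum.swap) (simp add: w_def right_diff_distrib sum_subtractf sum_distrib_left sum_divide_distrib)
  \<comment> \<open>Both sides are the trace of \<open>K * transpose_mat K\<close>.\<close>
  also have "(\<Sum>l<N. \<eta> l) = (\<Sum>j<N. \<Sum>i<N. (K $$ (i, j))\<^sup>2)"
  proof -
    have "(\<Sum>j<N. \<Sum>i<N. (K $$ (i, j))\<^sup>2) = (\<Sum>i<N. \<Sum>a<N. K $$ (i, a) * K $$ (i, a))"
      by (subst sum.swap) (simp add: power2_eq_square)
    also have "\<dots> = (\<Sum>i<N. \<Sum>l<N. \<eta> l * (U $$ (i, l))\<^sup>2)"
      by (rule sum.cong[OF refl]) (simp add: KK power2_eq_square ac_simps)
    also have "\<dots> = (\<Sum>l<N. \<eta> l * (\<Sum>i<N. (U $$ (i, l))\<^sup>2))"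
      by (subst sum.swap) (simp add: sum_distrib_left)
    finally show ?thesis by (simp add: colU)
  qed
  also have "(\<Sum>k\<in>{1..d}. \<Sum>l<N. \<eta> l * (\<Sum>i<N. U $$ (i, l) * \<alpha> k i)\<^sup>2) = (\<Sum>k\<in>{1..d}. \<Sum>j<N. (\<Sum>i<N. K $$ (i, j) * \<alpha> k i)\<^sup>2)"
    by (simp only: UK)
  finally have "2 * Xi d K \<le> (\<Sum>j<N. 2 * (\<Sum>i<N. (K $$ (i, j))\<^sup>2)) - (\<Sum>k\<in>{1..d}. \<Sum>j<N. (\<Sum>i<N. K $$ (i, j) * \<alpha> k i)\<^sup>2)"
    unfolding sum_distrib_left[symmetric] by linarith
  also have "\<dots> = (\<Sum>j<N. 2 * (\<Sum>i<N. (K $$ (i, j))\<^sup>2) - (\<Sum>k\<in>{1..d}. (\<Sum>i<N. K $$ (i, j) * \<alpha> k i)\<^sup>2))"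
    by (subst sum.swap) (simp add: sum_subtractf)
  finally have "2 / real d ^ 4 * (2 * Xi d K) \<le> (norm2 (lmm_operator d K - local_measurement d P (lmm_operator d K)))\<^sup>2"
    unfolding norm2_lmm_diff_measurement[OF K[unfolded N_def] P] \<alpha>_def N_def
    by (intro mult_left_mono) auto
  then show ?thesis by simp
qed

lemma Xi_nonneg:
  assumes d: "2 \<le> d" and K: "K \<in> carrier_mat (d\<^sup>2 - 1) (d\<^sup>2 - 1)"
  shows "0 \<le> Xi d K"
proof (rule mult_transpose_spectral[OF K])
  fix U
  assume "\<And>l. l < d\<^sup>2 - 1 \<Longrightarrow> eigenvalues_desc (K * transpose_mat K) ! l =
      (\<Sum>a<d\<^sup>2 - 1. (\<Sum>i<d\<^sup>2 - 1. U $$ (i, l) * K $$ (i, a))\<^sup>2)"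
  then have "0 \<le> eigenvalues_desc (K * transpose_mat K) ! l" if "l < d\<^sup>2 - 1" for l
    using that by (simp add: sum_nonneg)
  then show ?thesis using d by (subst Xi_eq) (auto intro!: sum_nonneg)
qed

text \<open>A sum of non-negative eigenvalues vanishes only termwise; then all but
  \<open>d - 1\<close> of them are zero, and the rank of \<open>K\<close> is at most
  \<open>d - 1\<close>.\<close>

lemma Xi_pos:
  assumes d: "2 \<le> d" and K: "K \<in> carrier_mat (d\<^sup>2 - 1) (d\<^sup>2 - 1)"
    and rank: "d \<le> vec_space.rank (d\<^sup>2 - 1) K"
  shows "0 < Xi d K"
proof (rule mult_transpose_spectral[OF K], rule ccontr)
  let ?N = "d\<^sup>2 - 1" and ?e = "\<lambda>l. eigenvalues_desc (K * transpose_mat K) ! l"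
  fix U
  assume U: "U \<in> carrier_mat ?N ?N" "mat_adjoint U * U = 1\<^sub>m ?N"
    and e: "\<And>l. l < ?N \<Longrightarrow> ?e l = (\<Sum>a<?N. (\<Sum>i<?N. U $$ (i, l) * K $$ (i, a))\<^sup>2)"
  assume "\<not> 0 < Xi d K"
  then have "(\<Sum>l=d - 1..<?N. ?e l) = 0" using Xi_nonneg[OF d K] Xi_eq[of d K] d by simp
  moreover have "0 \<le> ?e l" if "l < ?N" for l
    unfolding e[OF that] by (simp add: sum_nonneg)
  ultimately have "\<forall>l\<in>{d - 1..<?N}. ?e l = 0"
    by (subst (asm) sum_nonneg_eq_0_iff) auto
  then have "(\<Sum>a<?N. (\<Sum>i<?N. U $$ (i, l) * K $$ (i, a))\<^sup>2) = 0" if "d - 1 \<le> l" "l < ?N" for l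
    using that unfolding e[OF that(2), symmetric] by simp
  moreover have "d - 1 \<le> ?N" by (cases d) (auto simp: power2_eq_square)
  ultimately have "vec_space.rank ?N K \<le> d - 1"
    by (rule rank_le_if_eigenvalues_zero[OF K U])
  then show False using rank d by linarith
qed

text \<open>Ensures that the infima in the two discords run over a non-empty set, so that a lower
  bound for all measurements passes to them.\<close>

lemma projective_measurement_standard:
  "projective_measurement d (\<lambda>k. matrix_unit d k k)"
proof -
  have "orthogonal_projector d (matrix_unit d k k)" for k
    unfolding orthogonal_projector_def
    by (auto simp: matrix_unit_def scalar_prod_def if_distrib cong: if_cong intro!: eq_matI)
  moreover have "vec_space.rank d (matrix_unit d k k) = 1" if "k \<in> {1..d}" for k
  proof -
    interpret vec_space "TYPE(complex)" d .
    let ?E = "matrix_unit d k k" and ?u = "unit_vec d (k - 1) :: complex vec"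
    have E: "?E \<in> carrier_mat d d" by (simp add: matrix_unit_def)
    have "rank ?E \<le> 1"
      by (rule rank_le_1_product_entries[OF E, of "\<lambda>r. if r + 1 = k then 1 else 0" "\<lambda>r. if r + 1 = k then 1 else 0"])
        (auto simp: matrix_unit_def)
    moreover have "col ?E (k - 1) = ?u"
      using that by (intro eq_vecI) (auto simp: matrix_unit_def)
    then have "{?u} \<subseteq> set (cols ?E)"
      using that E by (auto simp: cols_def intro!: image_eqI[of _ _ "k - 1"])
    moreover have ind0: "lin_indpt {}" by (auto simp: lin_dep_def)
    have "lin_indpt {?u}"
    proof
      assume "lin_dep {?u}"
      then have "?u = 0\<^sub>v d"
        using lin_dep_iff_in_span[of "{}" ?u] ind0 span_empty by auto
      from arg_cong[OF this, of "\<lambda>v. v $ (k - 1)"] show False using that by (subst (asm) index_unit_vec) auto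
    qed
    ultimately show ?thesis using rank_ge_card_indpt[OF E, of "{?u}"] by simp
  qed
  moreover have "matrix_unit d j j * matrix_unit d k k = 0\<^sub>m d d" if "j \<noteq> k" for j k
    using that by (intro eq_matI) (auto simp: matrix_unit_def scalar_prod_def intro!: sum.neutral)
  moreover have "sum_square_mats d {1..d} (\<lambda>k. matrix_unit d k k) = 1\<^sub>m d"
  proof (rule eq_matI)
    fix a b assume "a < dim_row (1\<^sub>m d :: complex mat)" "b < dim_col (1\<^sub>m d :: complex mat)"
    then have ab: "a < d" "b < d" by auto
    have "(\<Sum>k\<in>{1..d}. matrix_unit d k k $$ (a, b)) = (\<Sum>k\<in>{1..d}. if k = a + 1 then (if a = b then 1 else 0) else 0)"
      using ab by (intro sum.cong refl) (auto simp: matrix_unit_def)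
    then show "sum_square_mats d {1..d} (\<lambda>k. matrix_unit d k k) $$ (a, b) = 1\<^sub>m d $$ (a, b)"
      using ab by simp
  qed (auto simp: sum_square_mats_def)
  ultimately show ?thesis unfolding projective_measurement_def by auto
qed

theorem theorem1:
  fixes d :: nat and K :: "real mat" and \<rho> :: "complex mat"
  assumes "d \<ge> 3"
    and "K \<in> correlation_matrices d"
    and "locally_maximally_mixed d \<rho>"
    and "\<rho> = lmm_operator d K"
  shows "discord2 d \<rho> \<ge> 4 / (real d ^ 3 * (real d - 1)) * Xi d K
    \<and> discord1 d \<rho> \<ge> 1 / (real d * (real d - 1)) * sqrt (Xi d K)
    \<and> (vec_space.rank (d\<^sup>2 - 1) K \<ge> d \<longrightarrow> discord1 d \<rho> > 0 \<and> discord2 d \<rho> > 0)"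
proof -
  have K: "K \<in> carrier_mat (d\<^sup>2 - 1) (d\<^sup>2 - 1)" using assms(2) by (simp add: correlation_matrices_def)
  have d: "2 \<le> d" using assms(1) by simp
  let ?M = "{P. projective_measurement d P}"
  have ne: "?M \<noteq> {}" using projective_measurement_standard by auto
  note bound = norm2_lmm_diff_measurement_ge[OF d K, folded assms(4)]
  have "4 / real d ^ 4 * Xi d K \<le> (INF P\<in>?M. (norm2 (\<rho> - local_measurement d P \<rho>))\<^sup>2)"
    by (rule cINF_greatest[OF ne]) (use bound in auto)
  then have "real d / (real d - 1) * (4 / real d ^ 4 * Xi d K) \<le> discord2 d \<rho>"
    unfolding discord2_def using d by (intro mult_left_mono) auto
  moreover have "real d / (real d - 1) * (4 / real d ^ 4 * Xi d K) = 4 / (real d ^ 3 * (real d - 1)) * Xi d K"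
    using d by (simp add: power_eq_if)
  ultimately have D2: "4 / (real d ^ 3 * (real d - 1)) * Xi d K \<le> discord2 d \<rho>" by simp
  \<comment> \<open>The left-hand side is the square root of the bound
    \<open>4 / real d ^ 4 * Xi d K\<close> for the squared 2-norm, which is in turn dominated by the
    trace norm.\<close>
  have "2 / (real d)\<^sup>2 * sqrt (Xi d K) \<le> norm1 (\<rho> - local_measurement d P \<rho>)" if "projective_measurement d P" for P
  proof -
    have R: "\<rho> - local_measurement d P \<rho> \<in> carrier_mat (d * d) (d * d)" by (intro minus_carrier_mat) simp
    have "(2 / (real d)\<^sup>2 * sqrt (Xi d K))\<^sup>2 = 4 / real d ^ 4 * Xi d K"
      using Xi_nonneg[OF d K] by (simp add: power_mult_distrib power_divide flip: power_mult)
    then have "2 / (real d)\<^sup>2 * sqrt (Xi d K) \<le> norm2 (\<rho> - local_measurement d P \<rho>)"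
      by (intro power2_le_imp_le[OF _ norm2_nonneg[OF R]]) (use bound[OF that] in simp)
    also have "\<dots> \<le> norm1 (\<rho> - local_measurement d P \<rho>)" by (rule norm2_le_norm1[OF R])
    finally show ?thesis .
  qed
  then have "2 / (real d)\<^sup>2 * sqrt (Xi d K) \<le> (INF P\<in>?M. norm1 (\<rho> - local_measurement d P \<rho>))"
    by (intro cINF_greatest[OF ne]) auto
  then have "real d / (2 * (real d - 1)) * (2 / (real d)\<^sup>2 * sqrt (Xi d K)) \<le> discord1 d \<rho>"
    unfolding discord1_def using d by (intro mult_left_mono) auto
  moreover have "real d / (2 * (real d - 1)) * (2 / (real d)\<^sup>2 * sqrt (Xi d K)) = 1 / (real d * (real d - 1)) * sqrt (Xi d K)"
    using d by (simp add: power2_eq_square divide_simps)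
  ultimately have D1: "1 / (real d * (real d - 1)) * sqrt (Xi d K) \<le> discord1 d \<rho>" by simp
  have "0 < discord1 d \<rho> \<and> 0 < discord2 d \<rho>" if "d \<le> vec_space.rank (d\<^sup>2 - 1) K"
  proof -
    have "0 < Xi d K" by (rule Xi_pos[OF d K that])
    then have "0 < 4 / (real d ^ 3 * (real d - 1)) * Xi d K" "0 < 1 / (real d * (real d - 1)) * sqrt (Xi d K)"
      using d by auto
    then show ?thesis using D1 D2 by linarith
  qed
  then show ?thesis using D1 D2 by blast
qed

end
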